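(* In the incidence Hopf algebra $\mathcal I$, for all $k,l\ge0$ and $o\in\{0,1\}$ such that $P_{k+l,k,o}$ is defined, one has $$\Delta\Big(\frac{[P_{k+l,k,o}]}{l!\,(k-o)!}\Big)=\sum_{\substack{p,q\ge0,\ p+q\ge1\\ p\ge o}}\ \sum_{(l_i),(k_i)}\ \prod_{i=1}^{p}\frac{[P_{l_i+k_i,k_i,1}]}{l_i!\,(k_i-1)!}\prod_{i=p+1}^{p+q}\frac{[P_{l_i+k_i,k_i,0}]}{l_i!\,k_i!}\otimes\frac{[P_{p+q,p,o}]}{q!\,(p-o)!}.$$ The inner sum runs over all tuples $(l_1,\dots,l_{p+q})$ and $(k_1,\dots,k_{p+q})$ of integers such that: - $l_1,\dots,l_p\ge0$ and $l_{p+1},\dots,l_{p+q}\ge1$, with $\sum l_i=l$; - $k_1,\dots,k_p\ge1$ and $k_{p+1},\dots,k_{p+q}\ge0$, with $\sum k_i=k$.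
   Context: Let $V_1,V_2$ be disjoint finite sets, $V=V_1\sqcup V_2$. A semi-pointed partition of $(V_1,V_2)$ is a set partition of $V$ into nonempty blocks in which each block $B$ is either unpointed or pointed at one chosen element of $B\cap V_1$, subject to: a block contained in $V_1$ must be pointed, and a block contained in $V_2$ must be unpointed. $\Pi(V_1,V_2)$ is the set of semi-pointed partitions, ordered by: $P\le Q$ iff every block $b$ of $P$ is a union $q_1\cup\dots\cup q_r$ of blocks of $Q$, and if $b$ is pointed at $e$ then some $q_i$ is pointed at $e$, while if $b$ is unpointed then some $q_i$ is unpointed. Its greatest element is the partition into singletons. $\Pi_{n,p}:=\Pi(\{1,\dots,p\},\{p+1,\dots,n\})$. For $n\ge1$, $0\le p\le n$ and $o\in\{0,1\}$ define $P_{n,p,o}$: - $P_{n,p,1}$ (defined when $p\ge1$) is the dual (order-reversed) poset of the maximal interval of $\Pi_{n,p}$ whose least element is the block $\{1,\dots,n\}$ pointed at $1$; - $P_{n,p,0}$ (defined when $p<n$) is the dual of the maximal interval whose least element is the unpointed block $\{1,\dots,n\}$. In the dual, the least element is the partition into singletons and the greatest element is the one-block partition. Let $\mathcal F$ be the family of finite direct products of such posets; it is closed under taking intervals. Two posets of $\mathcal F$ are identified when they are isomorphic through an isomorphism preserving the numbers of pointed and unpointed blocks of their least and greatest elements, and all one-element posets are identified with the unit. $\mathcal I$ is Schmitt's incidence Hopf algebra over $\mathbb Q$: it has basis the classes $[P]$, the product is induced by direct product (so $[P\times Q]=[P][Q]$), the unit is the class of one-element posets, and $\Delta[P]=\sum_{x\in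 P}[\hat0_P,x]\otimes[x,\hat1_P]$. In particular $[P_{1,1,1}]=[P_{1,0,0}]=1$.
   Formalization: When o=0 the sum as written includes terms with q=0, whose right factor [P_{p,p,0}] is not defined (e.g. k=l=1, p=1, q=0); these terms are omitted, i.e. the sum runs only over p,q for which P_{p+q,p,o} is defined. *)

theory Defs
  imports Complex_Main
begin

text \<open>A block is a pair (B, pt): B the underlying set, pt = None if the block is
unpointed, pt = Some e if it is pointed at e.  A semi-pointed partition is a set of blocks.\<close>

type_synonym blk = "nat set \<times> nat option"
type_synonym spp = "blk set"

definition sp_partition :: "nat set \<Rightarrow> nat set \<Rightarrow> spp \<Rightarrow> bool" where
  "sp_partition V1 V2 P \<longleftrightarrow>
     finite P \<and>
     \<Union> (fst ` P) = V1 \<union> V2 \<and>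
     (\<forall>b\<in>P. fst b \<noteq> {}) \<and>
     (\<forall>b\<in>P. \<forall>c\<in>P. b \<noteq> c \<longrightarrow> fst b \<inter> fst c = {}) \<and>
     (\<forall>b\<in>P. \<forall>e. snd b = Some e \<longrightarrow> e \<in> fst b \<inter> V1) \<and>
     (\<forall>b\<in>P. fst b \<subseteq> V1 \<longrightarrow> snd b \<noteq> None) \<and>
     (\<forall>b\<in>P. fst b \<subseteq> V2 \<longrightarrow> snd b = None)"

definition sp_le :: "spp \<Rightarrow> spp \<Rightarrow> bool" where
  "sp_le P Q \<longleftrightarrow>
     (\<forall>b\<in>P. \<exists>S\<subseteq>Q. fst b = \<Union> (fst ` S) \<and>
        (case snd b of
           Some e \<Rightarrow> (\<exists>q\<in>S. snd q = Some e)
         | None \<Rightarrow> (\<exists>q\<in>S. snd q = None)))"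

definition Pi_sp :: "nat set \<Rightarrow> nat set \<Rightarrow> spp set" where
  "Pi_sp V1 V2 = {P. sp_partition V1 V2 P}"

definition Pi_np :: "nat \<Rightarrow> nat \<Rightarrow> spp set" where
  "Pi_np n p = Pi_sp {1..p} {p+1..n}"

text \<open>Elements of a finite product of posets P_{n,p,ob} are represented as lists of
semi-pointed partitions (one per factor); a poset of F is represented by its carrier,
a set of such lists, ordered by the componentwise DUAL order of sp_le.\<close>

definition dle :: "spp list \<Rightarrow> spp list \<Rightarrow> bool" where
  "dle xs ys \<longleftrightarrow> list_all2 (\<lambda>a b. sp_le b a) xs ys"

definition one_block :: "nat \<Rightarrow> nat \<Rightarrow> spp" where
  "one_block n ob = {({1..n}, if ob = 1 then Some 1 else None)}"

definition Pdef :: "nat \<Rightarrow> nat \<Rightarrow> nat \<Rightarrow> bool" where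
  "Pdef n p ob \<longleftrightarrow> 1 \<le> n \<and> p \<le> n \<and> ob \<le> 1 \<and> (ob = 1 \<longrightarrow> 1 \<le> p) \<and> (ob = 0 \<longrightarrow> p < n)"

text \<open>Carrier of P_{n,p,ob}: the maximal interval of Pi_{n,p} with least element the
one-block partition, i.e. its up-set (the greatest element being the singletons);
the order is reversed via dle.\<close>

definition Pcar :: "nat \<Rightarrow> nat \<Rightarrow> nat \<Rightarrow> spp list set" where
  "Pcar n p ob = (\<lambda>x. [x]) ` {x \<in> Pi_np n p. sp_le (one_block n ob) x}"

fun prod_car :: "spp list set list \<Rightarrow> spp list set" where
  "prod_car [] = {[]}"
| "prod_car (C # Cs) = {x @ y | x y. x \<in> C \<and> y \<in> prod_car Cs}"

definition bot_of :: "spp list set \<Rightarrow> spp list" where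
  "bot_of C = (THE x. x \<in> C \<and> (\<forall>y\<in>C. dle x y))"

definition top_of :: "spp list set \<Rightarrow> spp list" where
  "top_of C = (THE x. x \<in> C \<and> (\<forall>y\<in>C. dle y x))"

definition intv :: "spp list set \<Rightarrow> spp list \<Rightarrow> spp list \<Rightarrow> spp list set" where
  "intv C a b = {x \<in> C. dle a x \<and> dle x b}"

definition npointed :: "spp list \<Rightarrow> nat" where
  "npointed xs = (\<Sum>P\<leftarrow>xs. card {b\<in>P. snd b \<noteq> None})"

definition nunpointed :: "spp list \<Rightarrow> nat" where
  "nunpointed xs = (\<Sum>P\<leftarrow>xs. card {b\<in>P. snd b = None})"

text \<open>The identification of posets defining the basis of the incidence Hopf algebra:
isomorphism preserving the numbers of pointed/unpointed blocks of the least and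
greatest elements; all one-element posets are identified.\<close>

definition cls_eq :: "spp list set \<Rightarrow> spp list set \<Rightarrow> bool" where
  "cls_eq C D \<longleftrightarrow>
     (card C = 1 \<and> card D = 1) \<or>
     (\<exists>f. bij_betw f C D \<and> (\<forall>x\<in>C. \<forall>y\<in>C. dle x y \<longleftrightarrow> dle (f x) (f y)) \<and>
          npointed (bot_of C) = npointed (bot_of D) \<and>
          nunpointed (bot_of C) = nunpointed (bot_of D) \<and>
          npointed (top_of C) = npointed (top_of D) \<and>
          nunpointed (top_of C) = nunpointed (top_of D))"

text \<open>An element of I \<otimes> I is a finite linear combination of basis tensors [X] \<otimes> [Y].
Its coefficient at the basis element [X] \<otimes> [Y] for a family of terms
c i \<cdot> [A i] \<otimes> [B i] (i \<in> I) is the following sum.\<close>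

definition tensor_coeff ::
  "'i set \<Rightarrow> ('i \<Rightarrow> rat) \<Rightarrow> ('i \<Rightarrow> spp list set) \<Rightarrow> ('i \<Rightarrow> spp list set)
     \<Rightarrow> spp list set \<Rightarrow> spp list set \<Rightarrow> rat" where
  "tensor_coeff I c A B X Y = (\<Sum>i\<in>{i\<in>I. cls_eq (A i) X \<and> cls_eq (B i) Y}. c i)"

definition Delta_coeff :: "spp list set \<Rightarrow> spp list set \<Rightarrow> spp list set \<Rightarrow> rat" where
  "Delta_coeff C X Y =
     tensor_coeff C (\<lambda>_. 1) (\<lambda>x. intv C (bot_of C) x) (\<lambda>x. intv C x (top_of C)) X Y"

text \<open>Index set: (p, q, ls, ks), ls = (l_1..l_{p+q}) and ks = (k_1..k_{p+q}) as lists
(index i-1 in the list for l_i).  Terms whose right factor P_{p+q,p,ob} is undefined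
are omitted (read as 0).\<close>

definition rhs_index :: "nat \<Rightarrow> nat \<Rightarrow> nat \<Rightarrow> (nat \<times> nat \<times> nat list \<times> nat list) set" where
  "rhs_index k l ob = {(p, q, ls, ks). p + q \<ge> 1 \<and> p \<ge> ob \<and> Pdef (p+q) p ob \<and>
      length ls = p + q \<and> length ks = p + q \<and>
      (\<forall>i<p+q. p \<le> i \<longrightarrow> 1 \<le> ls ! i) \<and> sum_list ls = l \<and>
      (\<forall>i<p. 1 \<le> ks ! i) \<and> sum_list ks = k}"

definition rhs_left :: "nat \<times> nat \<times> nat list \<times> nat list \<Rightarrow> spp list set" where
  "rhs_left t = (case t of (p, q, ls, ks) \<Rightarrow>
     prod_car (map (\<lambda>i. Pcar (ls!i + ks!i) (ks!i) (if i < p then 1 else 0)) [0..<p+q]))"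

definition rhs_right :: "nat \<Rightarrow> nat \<times> nat \<times> nat list \<times> nat list \<Rightarrow> spp list set" where
  "rhs_right ob t = (case t of (p, q, ls, ks) \<Rightarrow> Pcar (p+q) p ob)"

definition rhs_coeff :: "nat \<Rightarrow> nat \<times> nat \<times> nat list \<times> nat list \<Rightarrow> rat" where
  "rhs_coeff ob t = (case t of (p, q, ls, ks) \<Rightarrow>
     (\<Prod>i<p. 1 / (fact (ls!i) * fact (ks!i - 1))) *
     (\<Prod>i\<in>{p..<p+q}. 1 / (fact (ls!i) * fact (ks!i))) *
     (1 / (fact q * fact (p - ob))))"

end

theory Submission
  imports Defs "HOL-Combinatorics.Multiset_Permutations"
begin

text \<open>Fix x in P_{k+l,k,o} with p pointed and q unpointed blocks. Above x, a semi-pointed partition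
restricts independently to the blocks of x, so the interval from the singletons to x is the product
of the posets attached to the blocks; below x, it only sees the blocks of x as points, so the
interval from x to the top is P_{p+q,p,o}. The coefficients come from counting the
\<^emph>\<open>arrangements\<close> of x, the listings of its blocks with the pointed blocks first, and the block
pointed at 1 in front when o = 1. Every x has q!(p-o)! arrangements, while the arrangements whose
blocks have prescribed sizes are counted by l!(k-o)! divided by the product of the factorials on
the right-hand side.\<close>

section \<open>Semi-pointed partitions and their order\<close>

text \<open>The left-hand side runs over unordered partitions, the right-hand side over ordered
  tuples, and different tuples may give the same pair of classes. Comparing coefficients directly
  would require deciding when two products of posets are identified. This is avoided by writing both
  sides as sums over arrangements whose summand depends only on the tuple of sizes; of
  \<open>cls_eq\<close> only symmetry and transitivity enter there, to exchange an interval for its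
  representative. Each representative needs an explicit isomorphism together with equal pointed and
  unpointed counts at both ends.

  The shift by o has a single source. The greatest element of P_{n,p,1} is pointed at 1, so the
  block carrying the prescribed mark must get label 1, hence the first place in the list. This
  leaves p-1 pointed blocks to permute, and it fixes the point of the first block, which removes a
  factor k from k!.

  \<open>dle\<close> reverses \<open>sp_le\<close>: the first tensor factor consists of the
  refinements of x, the second of its coarsenings.\<close>

definition disj_blocks :: "spp \<Rightarrow> bool" where
  "disj_blocks P \<longleftrightarrow> (\<forall>b\<in>P. \<forall>c\<in>P. fst b \<inter> fst c \<noteq> {} \<longrightarrow> b = c)"

definition well_pointed :: "nat set \<Rightarrow> nat set \<Rightarrow> blk \<Rightarrow> bool" where
  "well_pointed V1 V2 b \<longleftrightarrow>
     (case snd b of Some e \<Rightarrow> e \<in> fst b \<inter> V1 | None \<Rightarrow> fst b \<inter> V2 \<noteq> {})"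

lemma well_pointed_nonempty: "well_pointed V1 V2 b \<Longrightarrow> fst b \<noteq> {}"
  by (auto simp: well_pointed_def split: option.splits)

text \<open>An unpointed block cannot lie inside \<open>V1\<close>, so it meets \<open>V2\<close>; a
  pointed one has its point in \<open>V1\<close>, so it does not lie inside \<open>V2\<close>. Hence
  the single condition \<open>well_pointed\<close> replaces nonemptiness and all clauses on
  marks.\<close>

lemma sp_partition_iff:
  assumes "V1 \<inter> V2 = {}"
  shows "sp_partition V1 V2 P \<longleftrightarrow> finite P \<and> \<Union> (fst ` P) = V1 \<union> V2 \<and> disj_blocks P \<and>
           (\<forall>b\<in>P. well_pointed V1 V2 b)" (is "?L \<longleftrightarrow> ?R")
proof
  assume L: ?L
  have "well_pointed V1 V2 b" if b: "b \<in> P" for b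
  proof (cases "snd b")
    case None
    have "\<not> fst b \<subseteq> V1" "fst b \<subseteq> V1 \<union> V2"
      using L b None by (auto simp: sp_partition_def)
    then show ?thesis using None by (auto simp: well_pointed_def)
  next
    case (Some e)
    then show ?thesis using L b by (auto simp: sp_partition_def well_pointed_def)
  qed
  then show ?R using L unfolding sp_partition_def disj_blocks_def by blast
next
  assume R: ?R
  have "(\<forall>e. snd b = Some e \<longrightarrow> e \<in> fst b \<inter> V1) \<and> (fst b \<subseteq> V1 \<longrightarrow> snd b \<noteq> None)
     \<and> (fst b \<subseteq> V2 \<longrightarrow> snd b = None)" if b: "b \<in> P" for b
  proof -
    have "well_pointed V1 V2 b" using R b by auto
    then show ?thesis using assms
      by (cases "snd b") (auto simp: well_pointed_def)
  qed
  moreover have "\<forall>b\<in>P. fst b \<noteq> {}" using R well_pointed_nonempty by metis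
  moreover have "\<forall>b\<in>P. \<forall>c\<in>P. b \<noteq> c \<longrightarrow> fst b \<inter> fst c = {}"
    using R unfolding disj_blocks_def by metis
  ultimately show ?L using R unfolding sp_partition_def by (intro conjI) simp_all
qed

lemma sp_partitionD:
  assumes "sp_partition V1 V2 P"
  shows "finite P" "\<Union> (fst ` P) = V1 \<union> V2" "\<And>b. b \<in> P \<Longrightarrow> fst b \<noteq> {}"
    "\<And>b. b \<in> P \<Longrightarrow> fst b \<subseteq> V1 \<union> V2"
    "\<And>b c v. b \<in> P \<Longrightarrow> c \<in> P \<Longrightarrow> v \<in> fst b \<Longrightarrow> v \<in> fst c \<Longrightarrow> b = c"
    "\<And>v. v \<in> V1 \<union> V2 \<Longrightarrow> \<exists>b\<in>P. v \<in> fst b"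
    "\<And>b e. b \<in> P \<Longrightarrow> snd b = Some e \<Longrightarrow> e \<in> fst b \<and> e \<in> V1"
    "\<And>b. b \<in> P \<Longrightarrow> snd b = None \<Longrightarrow> \<exists>v\<in>fst b. v \<in> V2"
proof -
  have U: "\<Union> (fst ` P) = V1 \<union> V2"
    and disj: "\<forall>b\<in>P. \<forall>c\<in>P. b \<noteq> c \<longrightarrow> fst b \<inter> fst c = {}"
    and pt: "\<forall>b\<in>P. \<forall>e. snd b = Some e \<longrightarrow> e \<in> fst b \<inter> V1"
    and unpt: "\<forall>b\<in>P. fst b \<subseteq> V1 \<longrightarrow> snd b \<noteq> None"
    using assms unfolding sp_partition_def by simp_all
  show "finite P" "\<And>b. b \<in> P \<Longrightarrow> fst b \<noteq> {}"
    using assms unfolding sp_partition_def by simp_all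
  show "\<Union> (fst ` P) = V1 \<union> V2" by (rule U)
  show sub: "\<And>b. b \<in> P \<Longrightarrow> fst b \<subseteq> V1 \<union> V2" using U by blast
  show "\<And>b c v. b \<in> P \<Longrightarrow> c \<in> P \<Longrightarrow> v \<in> fst b \<Longrightarrow> v \<in> fst c \<Longrightarrow> b = c" using disj by blast
  show "\<And>v. v \<in> V1 \<union> V2 \<Longrightarrow> \<exists>b\<in>P. v \<in> fst b" unfolding U[symmetric] by blast
  show "\<And>b e. b \<in> P \<Longrightarrow> snd b = Some e \<Longrightarrow> e \<in> fst b \<and> e \<in> V1" using pt by blast
  fix b assume b: "b \<in> P" "snd b = None"
  then have "\<not> fst b \<subseteq> V1" using unpt by blast
  then show "\<exists>v\<in>fst b. v \<in> V2" using sub[OF b(1)] by blast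
qed

text \<open>Disjointness leaves no freedom in the family \<open>S\<close>: it consists of all blocks
  of \<open>Q\<close> inside \<open>b\<close>. What remains of the order is refinement, together
  with the presence inside each block of \<open>P\<close> of a block of \<open>Q\<close> with the
  same mark. No pointing condition is assumed, so that a one-block family not known to be well
  pointed is covered too.\<close>

lemma sp_le_iff:
  assumes P: "disj_blocks P" and PQ: "\<Union> (fst ` P) = \<Union> (fst ` Q)"
    and Q: "disj_blocks Q" "\<And>q. q \<in> Q \<Longrightarrow> fst q \<noteq> {}"
  shows "sp_le P Q \<longleftrightarrow> (\<forall>q\<in>Q. \<exists>b\<in>P. fst q \<subseteq> fst b) \<and>
           (\<forall>b\<in>P. \<exists>q\<in>Q. fst q \<subseteq> fst b \<and> snd q = snd b)"
proof -
  have le: "sp_le P Q \<longleftrightarrow> (\<forall>b\<in>P. \<exists>S\<subseteq>Q. fst b = \<Union> (fst ` S) \<and> (\<exists>q\<in>S. snd q = snd b))"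
    unfolding sp_le_def by (intro ball_cong ex_cong refl) (auto split: option.splits)
  show ?thesis
  proof
    assume L: "sp_le P Q"
    show "(\<forall>q\<in>Q. \<exists>b\<in>P. fst q \<subseteq> fst b) \<and> (\<forall>b\<in>P. \<exists>q\<in>Q. fst q \<subseteq> fst b \<and> snd q = snd b)"
    proof (intro conjI ballI)
      fix q assume q: "q \<in> Q"
      then obtain v where v: "v \<in> fst q" using Q(2) by blast
      then obtain b where b: "b \<in> P" "v \<in> fst b" using q PQ by blast
      then obtain S where S: "S \<subseteq> Q" "fst b = \<Union> (fst ` S)" using L le by meson
      then obtain q' where "q' \<in> S" "v \<in> fst q'" using b by auto
      then have "q = q'" using Q(1) q v S unfolding disj_blocks_def by blast
      then show "\<exists>b\<in>P. fst q \<subseteq> fst b" using S \<open>q' \<in> S\<close> b by blast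
    next
      fix b assume b: "b \<in> P"
      then obtain S q where "S \<subseteq> Q" "fst b = \<Union> (fst ` S)" "q \<in> S" "snd q = snd b"
        using L le by meson
      then show "\<exists>q\<in>Q. fst q \<subseteq> fst b \<and> snd q = snd b" by blast
    qed
  next
    assume R: "(\<forall>q\<in>Q. \<exists>b\<in>P. fst q \<subseteq> fst b) \<and> (\<forall>b\<in>P. \<exists>q\<in>Q. fst q \<subseteq> fst b \<and> snd q = snd b)"
    show "sp_le P Q" unfolding le
    proof
      fix b assume b: "b \<in> P"
      let ?S = "{q \<in> Q. fst q \<subseteq> fst b}"
      have "v \<in> \<Union> (fst ` ?S)" if v: "v \<in> fst b" for v
      proof -
        obtain q where q: "q \<in> Q" "v \<in> fst q" using v b PQ by blast
        then obtain b' where b': "b' \<in> P" "fst q \<subseteq> fst b'" using R by blast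
        then have "b = b'" using P b v q unfolding disj_blocks_def by blast
        then show ?thesis using q b' by blast
      qed
      then have "fst b = \<Union> (fst ` ?S)" by blast
      moreover have "\<exists>q\<in>?S. snd q = snd b" using R b by blast
      ultimately show "\<exists>S\<subseteq>Q. fst b = \<Union> (fst ` S) \<and> (\<exists>q\<in>S. snd q = snd b)"
        by (intro exI[of _ ?S] conjI) simp_all
    qed
  qed
qed

lemma sp_partition_disj_blocks: "sp_partition V1 V2 P \<Longrightarrow> disj_blocks P"
  unfolding disj_blocks_def using sp_partitionD(5) by blast

lemma sp_le_partition_iff:
  assumes "sp_partition V1 V2 P" "sp_partition V1 V2 Q"
  shows "sp_le P Q \<longleftrightarrow> (\<forall>q\<in>Q. \<exists>b\<in>P. fst q \<subseteq> fst b) \<and>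
           (\<forall>b\<in>P. \<exists>q\<in>Q. fst q \<subseteq> fst b \<and> snd q = snd b)"
  using sp_partitionD(2,3)[OF assms(1)] sp_partitionD(2,3)[OF assms(2)]
    sp_partition_disj_blocks[OF assms(1)] sp_partition_disj_blocks[OF assms(2)]
  by (intro sp_le_iff) simp_all

lemma sp_le_refl: "sp_partition V1 V2 P \<Longrightarrow> sp_le P P"
  by (subst sp_le_partition_iff) auto

text \<open>A block of \<open>P\<close> contains a block of \<open>Q\<close> with the same mark and
  is contained in a block of \<open>Q\<close>; disjointness forces these two blocks of
  \<open>Q\<close> to coincide.\<close>

lemma sp_le_antisym:
  assumes P: "sp_partition V1 V2 P" and Q: "sp_partition V1 V2 Q" and "sp_le P Q" "sp_le Q P"
  shows "P = Q"
proof -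
  have *: "b \<in> Q" if P: "sp_partition V1 V2 P" and Q: "sp_partition V1 V2 Q"
    and PQ: "sp_le P Q" and QP: "sp_le Q P" and b: "b \<in> P" for P Q b
  proof -
    obtain q where q: "q \<in> Q" "fst q \<subseteq> fst b" "snd q = snd b"
      using PQ b unfolding sp_le_partition_iff[OF P Q] by blast
    obtain q' where q': "q' \<in> Q" "fst b \<subseteq> fst q'"
      using QP b unfolding sp_le_partition_iff[OF Q P] by blast
    obtain v where v: "v \<in> fst q" using sp_partitionD(3)[OF Q q(1)] by blast
    have "q = q'" using sp_partitionD(5)[OF Q q(1) q'(1) v] v q q' by blast
    then have "q = b" using q q' by (auto intro: prod_eqI)
    then show ?thesis using q by simp
  qed
  show ?thesis using *[OF P Q assms(3,4)] *[OF Q P assms(4,3)] by blast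
qed

text \<open>This is the up-set of the one-block partition with mark \<open>pt\<close>, by
  \<open>sp_le_one_block_iff\<close>. In this form, membership of an image can be checked on marks
  alone.\<close>

definition upset :: "nat set \<Rightarrow> nat set \<Rightarrow> nat option \<Rightarrow> spp set" where
  "upset V1 V2 pt = {x. sp_partition V1 V2 x \<and> (\<exists>q\<in>x. snd q = pt)}"

lemma sp_le_one_block_iff:
  assumes "sp_partition V1 V2 x"
  shows "sp_le {(V1 \<union> V2, pt)} x \<longleftrightarrow> (\<exists>q\<in>x. snd q = pt)"
proof -
  have "sp_le {(V1 \<union> V2, pt)} x \<longleftrightarrow> (\<forall>q\<in>x. \<exists>b\<in>{(V1 \<union> V2, pt)}. fst q \<subseteq> fst b) \<and>
           (\<forall>b\<in>{(V1 \<union> V2, pt)}. \<exists>q\<in>x. fst q \<subseteq> fst b \<and> snd q = snd b)"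
    using sp_partitionD(2,3)[OF assms] sp_partition_disj_blocks[OF assms]
    by (intro sp_le_iff) (simp_all add: disj_blocks_def)
  then show ?thesis using sp_partitionD(4)[OF assms] by auto
qed

lemma Pcar_eq:
  assumes "p \<le> n"
  shows "Pcar n p ob =
           (\<lambda>x. [x]) ` upset {1..p} {p+1..n} (if ob = 1 then Some 1 else None)"
proof -
  let ?pt = "if ob = 1 then Some 1 else None :: nat option"
  have U: "{1..n} = {1..p} \<union> {p+1..n}" using assms by auto
  have "x \<in> Pi_np n p \<and> sp_le (one_block n ob) x \<longleftrightarrow> x \<in> upset {1..p} {p+1..n} ?pt" for x
    unfolding upset_def Pi_np_def Pi_sp_def one_block_def mem_Collect_eq U
    using sp_le_one_block_iff[of "{1..p}" "{p+1..n}" x ?pt] by blast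
  then show ?thesis unfolding Pcar_def by simp
qed

definition singletons :: "nat set \<Rightarrow> nat set \<Rightarrow> spp" where
  "singletons V1 V2 = (\<lambda>v. ({v}, if v \<in> V1 then Some v else None)) ` (V1 \<union> V2)"

lemma sp_partition_singletons:
  assumes "finite V1" "finite V2" "V1 \<inter> V2 = {}"
  shows "sp_partition V1 V2 (singletons V1 V2)"
  unfolding sp_partition_iff[OF assms(3)] using assms
  by (auto simp: singletons_def disj_blocks_def well_pointed_def)

text \<open>A pointed block contains the singleton of its point; an unpointed one contains an
  element of \<open>V2\<close>, whose singleton is unpointed.\<close>

lemma sp_le_singletons:
  assumes "finite V1" "finite V2" "V1 \<inter> V2 = {}" and x: "sp_partition V1 V2 x"
  shows "sp_le x (singletons V1 V2)"
  unfolding sp_le_partition_iff[OF x sp_partition_singletons[OF assms(1-3)]]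
proof (intro conjI ballI)
  fix q assume "q \<in> singletons V1 V2"
  then show "\<exists>b\<in>x. fst q \<subseteq> fst b"
    using sp_partitionD(6)[OF x] unfolding singletons_def by fastforce
next
  fix b assume b: "b \<in> x"
  show "\<exists>q\<in>singletons V1 V2. fst q \<subseteq> fst b \<and> snd q = snd b"
  proof (cases "snd b")
    case None
    then show ?thesis
      using sp_partitionD(8)[OF x b] assms(3) by (fastforce simp: singletons_def)
  next
    case (Some e)
    then show ?thesis
      using sp_partitionD(7)[OF x b] by (auto simp: singletons_def)
  qed
qed

lemma singletons_in_upset:
  assumes "finite V1" "finite V2" "V1 \<inter> V2 = {}" and x: "x \<in> upset V1 V2 pt"
  shows "singletons V1 V2 \<in> upset V1 V2 pt"
proof -
  have x': "sp_partition V1 V2 x" using x by (simp add: upset_def)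
  obtain q where q: "q \<in> x" "snd q = pt" using x by (auto simp: upset_def)
  from sp_le_singletons[OF assms(1-3) x'] q show ?thesis
    unfolding upset_def sp_le_partition_iff[OF x' sp_partition_singletons[OF assms(1-3)]]
    using sp_partition_singletons[OF assms(1-3)] by auto
qed

lemma one_block_in_upset:
  assumes "V1 \<inter> V2 = {}" "well_pointed V1 V2 (V1 \<union> V2, pt)"
  shows "{(V1 \<union> V2, pt)} \<in> upset V1 V2 pt"
  using assms by (auto simp: upset_def sp_partition_iff disj_blocks_def)

section \<open>Symmetry and transitivity of the identification of posets\<close>

lemma cls_eq_sym: assumes "cls_eq C D" shows "cls_eq D C"
proof (cases "card C = 1 \<and> card D = 1")
  case True
  then show ?thesis by (simp add: cls_eq_def)
next
  case False
  then obtain f where f: "bij_betw f C D"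
    "\<forall>x\<in>C. \<forall>y\<in>C. dle x y \<longleftrightarrow> dle (f x) (f y)"
    and c: "npointed (bot_of C) = npointed (bot_of D)"
          "nunpointed (bot_of C) = nunpointed (bot_of D)"
          "npointed (top_of C) = npointed (top_of D)"
          "nunpointed (top_of C) = nunpointed (top_of D)"
    using assms unfolding cls_eq_def by blast
  have "bij_betw (inv_into C f) D C" by (rule bij_betw_inv_into[OF f(1)])
  moreover have "dle x y \<longleftrightarrow> dle (inv_into C f x) (inv_into C f y)"
    if "x \<in> D" "y \<in> D" for x y
    using f(2) that bij_betwE[OF \<open>bij_betw (inv_into C f) D C\<close>]
      bij_betw_inv_into_right[OF f(1)] by metis
  ultimately show ?thesis using c unfolding cls_eq_def by metis
qed

text \<open>The one-element clause compares no block counts, so the two clauses must not get mixed.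
  Identified posets have equal cardinality: if \<open>D\<close> has one element, so do
  \<open>C\<close> and \<open>E\<close>; otherwise both isomorphisms and all count equations
  compose.\<close>

lemma cls_eq_trans: assumes CD: "cls_eq C D" and DE: "cls_eq D E" shows "cls_eq C E"
proof -
  have card: "card X = card Y" if "cls_eq X Y" for X Y
    using that by (auto simp: cls_eq_def dest: bij_betw_same_card)
  show ?thesis
  proof (cases "card D = 1")
    case True
    then show ?thesis using card[OF CD] card[OF DE] by (simp add: cls_eq_def)
  next
    case False
    obtain f where f: "bij_betw f C D"
      "\<forall>x\<in>C. \<forall>y\<in>C. dle x y \<longleftrightarrow> dle (f x) (f y)"
      using False CD unfolding cls_eq_def by blast
    obtain g where g: "bij_betw g D E"
      "\<forall>x\<in>D. \<forall>y\<in>D. dle x y \<longleftrightarrow> dle (g x) (g y)"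
      using False DE unfolding cls_eq_def by blast
    have "bij_betw (g \<circ> f) C E" by (rule bij_betw_trans[OF f(1) g(1)])
    moreover have "\<forall>x\<in>C. \<forall>y\<in>C. dle x y \<longleftrightarrow> dle ((g \<circ> f) x) ((g \<circ> f) y)"
      using f(2) g(2) bij_betwE[OF f(1)] by simp
    ultimately show ?thesis using False CD DE unfolding cls_eq_def by (intro disjI2) auto
  qed
qed

lemma cls_eq_cong: "cls_eq A B \<Longrightarrow> cls_eq A X \<longleftrightarrow> cls_eq B X"
  using cls_eq_sym cls_eq_trans by blast

text \<open>An order embedding of a poset is automatically injective.\<close>

lemma cls_eqI:
  assumes img: "f ` C = D"
    and ord: "\<And>x y. x \<in> C \<Longrightarrow> y \<in> C \<Longrightarrow> dle x y \<longleftrightarrow> dle (f x) (f y)"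
    and refl: "\<And>x. x \<in> C \<Longrightarrow> dle x x"
    and antisym: "\<And>x y. x \<in> C \<Longrightarrow> y \<in> C \<Longrightarrow> dle x y \<Longrightarrow> dle y x \<Longrightarrow> x = y"
    and "npointed (bot_of C) = npointed (bot_of D)"
      "nunpointed (bot_of C) = nunpointed (bot_of D)"
      "npointed (top_of C) = npointed (top_of D)"
      "nunpointed (top_of C) = nunpointed (top_of D)"
  shows "cls_eq C D"
proof -
  have "inj_on f C"
  proof (rule inj_onI)
    fix x y assume xy: "x \<in> C" "y \<in> C" "f x = f y"
    then have "dle x y" "dle y x" using ord[of x y] ord[of y x] ord[of x x] refl[of x] by auto
    then show "x = y" using antisym xy by blast
  qed
  then have "bij_betw f C D" using img by (simp add: bij_betw_def)
  then show ?thesis unfolding cls_eq_def using assms by blast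
qed

lemma bot_of_eqI:
  assumes "x \<in> C" "\<And>y. y \<in> C \<Longrightarrow> dle x y"
    and "\<And>x y. x \<in> C \<Longrightarrow> y \<in> C \<Longrightarrow> dle x y \<Longrightarrow> dle y x \<Longrightarrow> x = y"
  shows "bot_of C = x"
  unfolding bot_of_def by (rule the_equality) (use assms in blast)+

lemma top_of_eqI:
  assumes "x \<in> C" "\<And>y. y \<in> C \<Longrightarrow> dle y x"
    and "\<And>x y. x \<in> C \<Longrightarrow> y \<in> C \<Longrightarrow> dle x y \<Longrightarrow> dle y x \<Longrightarrow> x = y"
  shows "top_of C = x"
  unfolding top_of_def by (rule the_equality) (use assms in blast)+

section \<open>Partitions below a given one\<close>

text \<open>A block pointed at a label \<open>i\<close> becomes pointed at the point of the block
  \<open>h i\<close>. The bind is there because the mark of \<open>h i\<close> is itself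
  optional.\<close>

definition expand_block :: "(nat \<Rightarrow> blk) \<Rightarrow> blk \<Rightarrow> blk" where
  "expand_block h b = (\<Union>i\<in>fst b. fst (h i), Option.bind (snd b) (\<lambda>i. snd (h i)))"

text \<open>If h labels the blocks of x, a partition z of the labels is turned into a coarsening of x. With
x the partition into singletons this is relabelling.\<close>

definition expand :: "(nat \<Rightarrow> blk) \<Rightarrow> spp \<Rightarrow> spp" where
  "expand h z = expand_block h ` z"

text \<open>The labels form a ground set with two parts of its own, \<open>V1\<close> for the
  pointed and \<open>V2\<close> for the unpointed blocks of \<open>x\<close>, so that partitions of
  the labels are again semi-pointed.\<close>

locale block_labelling =
  fixes V1 V2 W1 W2 :: "nat set" and x :: spp and h :: "nat \<Rightarrow> blk"
  assumes V: "V1 \<inter> V2 = {}" and W: "W1 \<inter> W2 = {}"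
    and x: "sp_partition W1 W2 x" and h: "bij_betw h (V1 \<union> V2) x"
    and pointed: "\<And>i. i \<in> V1 \<Longrightarrow> snd (h i) \<noteq> None"
    and unpointed: "\<And>i. i \<in> V2 \<Longrightarrow> snd (h i) = None"
begin

lemma h_in: "i \<in> V1 \<union> V2 \<Longrightarrow> h i \<in> x"
  using h by (auto simp: bij_betw_def)

lemma h_surj: "b \<in> x \<Longrightarrow> \<exists>i\<in>V1 \<union> V2. h i = b"
  using h by (auto simp: bij_betw_def)

lemma h_eq:
  assumes "i \<in> V1 \<union> V2" "j \<in> V1 \<union> V2" "v \<in> fst (h i)" "v \<in> fst (h j)"
  shows "i = j"
  using sp_partitionD(5)[OF x h_in[OF assms(1)] h_in[OF assms(2)] assms(3,4)] assms(1,2) h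
  by (auto simp: bij_betw_def inj_on_def)

lemma h_nonempty: "i \<in> V1 \<union> V2 \<Longrightarrow> \<exists>v. v \<in> fst (h i)"
  using sp_partitionD(3)[OF x h_in] by blast

lemma h_point:
  assumes "i \<in> V1"
  obtains e where "snd (h i) = Some e" "e \<in> fst (h i)" "e \<in> W1"
  using pointed[OF assms] sp_partitionD(7)[OF x h_in] assms by auto

lemma expand_block_subset_iff:
  assumes "fst b \<subseteq> V1 \<union> V2" "fst c \<subseteq> V1 \<union> V2"
  shows "fst (expand_block h b) \<subseteq> fst (expand_block h c) \<longleftrightarrow> fst b \<subseteq> fst c"
proof
  assume L: "fst (expand_block h b) \<subseteq> fst (expand_block h c)"
  show "fst b \<subseteq> fst c"
  proof
    fix i assume i: "i \<in> fst b"
    then obtain v where v: "v \<in> fst (h i)" using h_nonempty assms by blast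
    then have "v \<in> fst (expand_block h c)" using L i by (auto simp: expand_block_def)
    then obtain j where "j \<in> fst c" "v \<in> fst (h j)" by (auto simp: expand_block_def)
    then show "i \<in> fst c" using h_eq[of i j v] v i assms by blast
  qed
qed (auto simp: expand_block_def)

text \<open>The point of a block lies in it, so two labels whose blocks have the same point are
  equal.\<close>

lemma bind_point_eq_iff:
  assumes "set_option s \<subseteq> V1" "set_option t \<subseteq> V1"
  shows "Option.bind s (\<lambda>i. snd (h i)) = Option.bind t (\<lambda>i. snd (h i)) \<longleftrightarrow> s = t"
proof (cases s; cases t)
  fix i j assume st: "s = Some i" "t = Some j"
  then have ij: "i \<in> V1" "j \<in> V1" using assms by auto
  obtain e f where "snd (h i) = Some e" "e \<in> fst (h i)" "snd (h j) = Some f" "f \<in> fst (h j)"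
    using h_point ij by metis
  then show ?thesis using st h_eq[of i j e] ij by auto
next
  fix j assume "s = None" "t = Some j"
  then show ?thesis using assms pointed[of j] by auto
next
  fix i assume "s = Some i" "t = None"
  then show ?thesis using assms pointed[of i] by auto
qed simp

lemma well_pointed_point: "well_pointed V1 V2 b \<Longrightarrow> set_option (snd b) \<subseteq> V1"
  by (auto simp: well_pointed_def)

lemma expand_block_point_eq_iff:
  assumes "well_pointed V1 V2 b" "well_pointed V1 V2 c"
  shows "snd (expand_block h b) = snd (expand_block h c) \<longleftrightarrow> snd b = snd c"
  unfolding expand_block_def using bind_point_eq_iff assms well_pointed_point by simp

text \<open>An unpointed block contains a label from \<open>V2\<close>, and the block so labelled is
  unpointed and meets \<open>W2\<close>. For a block pointed at \<open>i\<close> the label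
  \<open>i\<close> serves, as \<open>h i\<close> has its own point in \<open>W1\<close>. The second
  claim supplies the mark condition in \<open>expand_le\<close>.\<close>

lemma well_pointed_expand_block:
  assumes "well_pointed V1 V2 b" "fst b \<subseteq> V1 \<union> V2"
  shows "well_pointed W1 W2 (expand_block h b)"
    and "\<exists>i\<in>fst b. snd (h i) = snd (expand_block h b)"
proof -
  have "well_pointed W1 W2 (expand_block h b) \<and> (\<exists>i\<in>fst b. snd (h i) = snd (expand_block h b))"
  proof (cases "snd b")
    case None
    then obtain i where i: "i \<in> fst b" "i \<in> V2" using assms by (auto simp: well_pointed_def)
    then have "snd (h i) = None" using unpointed by blast
    moreover obtain v where "v \<in> fst (h i)" "v \<in> W2"
      using sp_partitionD(8)[OF x h_in unpointed] i by blast
    ultimately show ?thesis using i None by (auto simp: expand_block_def well_pointed_def)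
  next
    case (Some i)
    then have i: "i \<in> fst b" "i \<in> V1" using assms by (auto simp: well_pointed_def)
    then obtain e where "snd (h i) = Some e" "e \<in> fst (h i)" "e \<in> W1" using h_point by blast
    then show ?thesis using i Some by (auto simp: expand_block_def well_pointed_def)
  qed
  then show "well_pointed W1 W2 (expand_block h b)"
    "\<exists>i\<in>fst b. snd (h i) = snd (expand_block h b)" by auto
qed

lemma partition_blocks:
  assumes "sp_partition V1 V2 z" "b \<in> z"
  shows "well_pointed V1 V2 b" "fst b \<subseteq> V1 \<union> V2"
  using assms V sp_partitionD(4)[OF assms] by (auto simp: sp_partition_iff)

lemma expand_partition:
  assumes z: "sp_partition V1 V2 z"
  shows "sp_partition W1 W2 (expand h z)"
  unfolding sp_partition_iff[OF W]
proof (intro conjI ballI)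
  show "finite (expand h z)" using sp_partitionD(1)[OF z] by (simp add: expand_def)
  have "\<Union> (fst ` expand h z) = (\<Union>i\<in>\<Union> (fst ` z). fst (h i))"
    by (auto simp: expand_def expand_block_def)
  also have "\<dots> = \<Union> (fst ` h ` (V1 \<union> V2))" unfolding sp_partitionD(2)[OF z] by auto
  also have "\<dots> = W1 \<union> W2" using sp_partitionD(2)[OF x] h by (simp add: bij_betw_def)
  finally show "\<Union> (fst ` expand h z) = W1 \<union> W2" .
  show "disj_blocks (expand h z)" unfolding disj_blocks_def
  proof (intro ballI impI)
    fix b' c' assume "b' \<in> expand h z" "c' \<in> expand h z" and n: "fst b' \<inter> fst c' \<noteq> {}"
    then obtain b c where bc: "b \<in> z" "c \<in> z" "b' = expand_block h b" "c' = expand_block h c"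
      by (auto simp: expand_def)
    then obtain i j v where "i \<in> fst b" "j \<in> fst c" "v \<in> fst (h i)" "v \<in> fst (h j)"
      using n by (auto simp: expand_block_def)
    moreover from this have "i = j"
      using h_eq[of i j v] partition_blocks(2)[OF z] bc by blast
    ultimately have "b = c" using sp_partitionD(5)[OF z] bc by blast
    then show "b' = c'" using bc by simp
  qed
  fix b assume "b \<in> expand h z"
  then show "well_pointed W1 W2 b"
    using well_pointed_expand_block(1) partition_blocks[OF z] by (auto simp: expand_def)
qed

lemma expand_le:
  assumes z: "sp_partition V1 V2 z"
  shows "sp_le (expand h z) x"
  unfolding sp_le_partition_iff[OF expand_partition[OF z] x]
proof (intro conjI ballI)
  fix q assume "q \<in> x"
  then obtain i where i: "i \<in> V1 \<union> V2" "q = h i" using h_surj by blast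
  then obtain b where "b \<in> z" "i \<in> fst b" using sp_partitionD(6)[OF z] by blast
  then show "\<exists>b\<in>expand h z. fst q \<subseteq> fst b"
    using i by (auto simp: expand_def expand_block_def)
next
  fix b' assume "b' \<in> expand h z"
  then obtain b where b: "b \<in> z" "b' = expand_block h b" by (auto simp: expand_def)
  then obtain i where i: "i \<in> fst b" "snd (h i) = snd b'"
    using well_pointed_expand_block(2) partition_blocks[OF z] by blast
  then have "h i \<in> x" using h_in partition_blocks[OF z] b by blast
  then show "\<exists>q\<in>x. fst q \<subseteq> fst b' \<and> snd q = snd b'"
    using i b by (auto simp: expand_block_def)
qed

text \<open>\<open>sp_le\<close> sees partitions only through inclusions of blocks and equality of
  marks, and \<open>expand_block\<close> preserves and reflects both.\<close>

lemma expand_le_iff: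
  assumes z: "sp_partition V1 V2 z" "sp_partition V1 V2 z'"
  shows "sp_le (expand h z) (expand h z') \<longleftrightarrow> sp_le z z'"
  unfolding sp_le_partition_iff[OF z]
    sp_le_partition_iff[OF expand_partition[OF z(1)] expand_partition[OF z(2)]]
  by (simp add: expand_def expand_block_subset_iff expand_block_point_eq_iff
      partition_blocks[OF z(1)] partition_blocks[OF z(2)] cong: conj_cong)

text \<open>Inverse of \<open>expand_block\<close> on the blocks of a coarsening of
  \<open>x\<close>. The choice of the label is in fact unique, because \<open>e\<close> lies in only
  one block of \<open>x\<close>.\<close>

definition contract_block :: "blk \<Rightarrow> blk" where
  "contract_block b = ({i \<in> V1 \<union> V2. fst (h i) \<subseteq> fst b},
     map_option (\<lambda>e. SOME i. i \<in> V1 \<union> V2 \<and> snd (h i) = Some e) (snd b))"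

lemma contract_block:
  assumes y: "sp_partition W1 W2 y" and le: "sp_le y x" and b: "b \<in> y"
  shows "well_pointed V1 V2 (contract_block b)" and "expand_block h (contract_block b) = b"
proof -
  note le' = le[unfolded sp_le_partition_iff[OF y x]]
  obtain q where q: "q \<in> x" "fst q \<subseteq> fst b" "snd q = snd b" using le' b by blast
  then obtain i where i: "i \<in> V1 \<union> V2" "h i = q" using h_surj by blast
  have "v \<in> (\<Union>i\<in>{i \<in> V1 \<union> V2. fst (h i) \<subseteq> fst b}. fst (h i))" if v: "v \<in> fst b" for v
  proof -
    obtain r where r: "r \<in> x" "v \<in> fst r"
      using sp_partitionD(6)[OF x] sp_partitionD(4)[OF y b] v by blast
    then obtain c where "c \<in> y" "fst r \<subseteq> fst c" using le' by blast
    moreover from this have "b = c" using sp_partitionD(5)[OF y b] v r by blast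
    ultimately show ?thesis using h_surj[OF r(1)] r by blast
  qed
  then have fst: "fst (expand_block h (contract_block b)) = fst b"
    by (auto simp: expand_block_def contract_block_def)
  have "well_pointed V1 V2 (contract_block b) \<and> snd (expand_block h (contract_block b)) = snd b"
  proof (cases "snd b")
    case None
    then have "i \<in> V2" using q i pointed[of i] by auto
    then have "well_pointed V1 V2 (contract_block b)"
      using None i q unfolding well_pointed_def contract_block_def by auto
    then show ?thesis using None by (simp add: contract_block_def expand_block_def)
  next
    case (Some e)
    define j where "j = (SOME j. j \<in> V1 \<union> V2 \<and> snd (h j) = Some e)"
    have j: "j \<in> V1 \<union> V2" "snd (h j) = Some e"
      using someI_ex[of "\<lambda>j. j \<in> V1 \<union> V2 \<and> snd (h j) = Some e"] i q Some
      unfolding j_def by auto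
    have "e \<in> fst (h j)" "e \<in> fst (h i)"
      using sp_partitionD(7)[OF x h_in] i q j Some by auto
    \<comment> \<open>The chosen label and the label of the block \<open>q\<close> with the mark of
      \<open>b\<close> name blocks that share the point \<open>e\<close>.\<close>
    then have "j = i" using h_eq i j by blast
    moreover have "i \<in> V1" using unpointed i q Some by force
    moreover have "snd (contract_block b) = Some j" by (simp add: contract_block_def j_def Some)
    ultimately show ?thesis using i q j Some
      by (simp add: well_pointed_def expand_block_def contract_block_def)
  qed
  then show "well_pointed V1 V2 (contract_block b)" "expand_block h (contract_block b) = b"
    using fst by (auto intro: prod_eqI)
qed

lemma expand_surj:
  assumes y: "sp_partition W1 W2 y" and le: "sp_le y x"
  obtains z where "sp_partition V1 V2 z" "expand h z = y"
proof
  let ?z = "contract_block ` y"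
  show "expand h ?z = y"
    using contract_block(2)[OF y le] by (force simp: expand_def image_iff)
  show "sp_partition V1 V2 ?z" unfolding sp_partition_iff[OF V]
  proof (intro conjI ballI)
    show "finite ?z" using sp_partitionD(1)[OF y] by simp
    have "\<exists>b\<in>y. i \<in> fst (contract_block b)" if i: "i \<in> V1 \<union> V2" for i
      using le[unfolded sp_le_partition_iff[OF y x]] h_in[OF i] i
      by (auto simp: contract_block_def)
    then have "V1 \<union> V2 \<subseteq> \<Union> (fst ` ?z)" by blast
    moreover have "\<Union> (fst ` ?z) \<subseteq> V1 \<union> V2" by (auto simp: contract_block_def)
    ultimately show "\<Union> (fst ` ?z) = V1 \<union> V2" by (rule equalityI[rotated])
    show "disj_blocks ?z" unfolding disj_blocks_def
    proof (intro ballI impI)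
      fix b' c' assume "b' \<in> ?z" "c' \<in> ?z" and n: "fst b' \<inter> fst c' \<noteq> {}"
      then obtain b c where bc: "b \<in> y" "c \<in> y" "b' = contract_block b" "c' = contract_block c"
        by auto
      then obtain i where i: "i \<in> V1 \<union> V2" "fst (h i) \<subseteq> fst b" "fst (h i) \<subseteq> fst c"
        using n by (auto simp: contract_block_def)
      then obtain v where "v \<in> fst (h i)" using h_nonempty by blast
      then have "b = c" using sp_partitionD(5)[OF y bc(1,2)] i by blast
      then show "b' = c'" using bc by simp
    qed
    show "well_pointed V1 V2 b" if "b \<in> ?z" for b using that contract_block(1)[OF y le] by auto
  qed
qed

text \<open>With \<open>expand_le_iff\<close> this is the isomorphism from a poset on labels onto
  the coarsenings of \<open>x\<close> with a prescribed mark. If \<open>x\<close> is the partition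
  into singletons, \<open>sp_le y x\<close> always holds and a relabelling results. Having
  \<open>pt\<close> in \<open>V1\<close> lets equality of marks be pulled back along
  \<open>h\<close>.\<close>

lemma expand_upset:
  assumes pt: "set_option pt \<subseteq> V1"
  shows "expand h ` upset V1 V2 pt =
    {y \<in> upset W1 W2 (Option.bind pt (\<lambda>i. snd (h i))). sp_le y x}"
proof -
  have iff: "(\<exists>q\<in>expand h z. snd q = Option.bind pt (\<lambda>i. snd (h i))) \<longleftrightarrow> (\<exists>q\<in>z. snd q = pt)"
    if z: "sp_partition V1 V2 z" for z
    using bind_point_eq_iff[OF well_pointed_point[OF partition_blocks(1)[OF z]] pt]
    by (auto simp: expand_def expand_block_def)
  show ?thesis
  proof (intro equalityI subsetI)
    fix y assume "y \<in> expand h ` upset V1 V2 pt"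
    then show "y \<in> {y \<in> upset W1 W2 (Option.bind pt (\<lambda>i. snd (h i))). sp_le y x}"
      using iff expand_partition expand_le by (auto simp: upset_def)
  next
    fix y assume y: "y \<in> {y \<in> upset W1 W2 (Option.bind pt (\<lambda>i. snd (h i))). sp_le y x}"
    then obtain z where z: "sp_partition V1 V2 z" "expand h z = y"
      using expand_surj unfolding upset_def by blast
    then have "z \<in> upset V1 V2 pt" using y iff[OF z(1)] by (simp add: upset_def)
    then show "y \<in> expand h ` upset V1 V2 pt" using z by blast
  qed
qed

end

section \<open>Intervals\<close>

definition restr :: "spp \<Rightarrow> blk \<Rightarrow> spp" where
  "restr y b = {c \<in> y. fst c \<subseteq> fst b}"

lemma dle_single [simp]: "dle [a] [b] \<longleftrightarrow> sp_le b a"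
  by (simp add: dle_def)

lemma dle_map_iff: "dle (map f bs) (map g bs) \<longleftrightarrow> (\<forall>b\<in>set bs. sp_le (g b) (f b))"
  by (simp add: dle_def list.rel_map list_all2_same)

lemma npointed_single: "npointed [P] = card {b \<in> P. snd b \<noteq> None}"
  by (simp add: npointed_def)

lemma nunpointed_single: "nunpointed [P] = card {b \<in> P. snd b = None}"
  by (simp add: nunpointed_def)

lemma npointed_one_block:
  "npointed [{(U, s)}] = (if s = None then 0 else 1)"
  "nunpointed [{(U, s)}] = (if s = None then 1 else 0)"
proof -
  have "{b \<in> {(U, s)}. snd b \<noteq> None} = (if s = None then {} else {(U, s)})"
    "{b \<in> {(U, s)}. snd b = None} = (if s = None then {(U, s)} else {})" by auto
  then show "npointed [{(U, s)}] = (if s = None then 0 else 1)"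
    "nunpointed [{(U, s)}] = (if s = None then 1 else 0)"
    by (simp_all only: npointed_single nunpointed_single) simp_all
qed

lemma npointed_singletons:
  assumes "V1 \<inter> V2 = {}"
  shows "npointed [singletons V1 V2] = card V1" "nunpointed [singletons V1 V2] = card V2"
proof -
  let ?f = "\<lambda>v. ({v}, if v \<in> V1 then Some v else None)"
  have inj: "inj_on ?f A" for A by (auto simp: inj_on_def)
  have "{b \<in> singletons V1 V2. snd b \<noteq> None} = ?f ` V1"
    "{b \<in> singletons V1 V2. snd b = None} = ?f ` V2"
    using assms by (auto simp: singletons_def split: if_splits)
  then show "npointed [singletons V1 V2] = card V1" "nunpointed [singletons V1 V2] = card V2"
    by (simp_all only: npointed_single nunpointed_single card_image[OF inj])
qed

text \<open>Distinct entries allow any choice of one component per position to be written as a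
  function \<open>w\<close> of the block, so that an element of the product is a block-indexed
  choice.\<close>

lemma prod_car_singletons:
  assumes "distinct bs"
  shows "prod_car (map (\<lambda>b. (\<lambda>x. [x]) ` D b) bs) = {map w bs | w. \<forall>b\<in>set bs. w b \<in> D b}"
  using assms
proof (induction bs)
  case (Cons b bs)
  have eq: "prod_car (map (\<lambda>b. (\<lambda>x. [x]) ` D b) (b # bs)) =
      {z # y | z y. z \<in> D b \<and> y \<in> prod_car (map (\<lambda>b. (\<lambda>x. [x]) ` D b) bs)}"
  proof -
    have "{x @ y | x y. x \<in> (\<lambda>x. [x]) ` E \<and> y \<in> C} = {z # y | z y. z \<in> E \<and> y \<in> C}"
      for E :: "spp set" and C by (intro equalityI subsetI; clarsimp) (metis append_Cons append_Nil imageI)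
    then show ?thesis by simp
  qed
  have "\<exists>w'. z # map w bs = map w' (b # bs) \<and> (\<forall>c\<in>set (b # bs). w' c \<in> D c)"
    if "z \<in> D b" "\<forall>c\<in>set bs. w c \<in> D c" for z w
    using that Cons.prems by (intro exI[of _ "w(b := z)"]) auto
  note ext = this
  have IH: "prod_car (map (\<lambda>b. (\<lambda>x. [x]) ` D b) bs) = {map w bs | w. \<forall>b\<in>set bs. w b \<in> D b}"
    using Cons by simp
  show ?case unfolding eq IH
  proof (intro equalityI subsetI)
    fix a assume "a \<in> {z # y | z y. z \<in> D b \<and> y \<in> {map w bs | w. \<forall>b\<in>set bs. w b \<in> D b}}"
    then obtain z w where "a = z # map w bs" "z \<in> D b" "\<forall>c\<in>set bs. w c \<in> D c" by blast
    then show "a \<in> {map w (b # bs) | w. \<forall>b\<in>set (b # bs). w b \<in> D b}" using ext by simp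
  qed auto
qed simp

text \<open>The standard pointed one-block partition is pointed at 1, so label 1 has to name the
  point \<open>e\<close> of the given block. An arbitrary bijection is corrected by the
  transposition of \<open>f 1\<close> and \<open>e\<close>.\<close>

lemma labelling_exists:
  assumes fin: "finite W1" "finite W2" and W: "W1 \<inter> W2 = {}"
    and wp: "well_pointed W1 W2 (W1 \<union> W2, s)"
  shows "\<exists>h. block_labelling {1..card W1} {card W1 + 1..card W2 + card W1} W1 W2
               (singletons W1 W2) h \<and>
             Option.bind (if s \<noteq> None then Some 1 else None) (\<lambda>i. snd (h i)) = s"
proof -
  have "\<exists>g. bij_betw g {1..card W1} W1 \<and> (\<forall>e. s = Some e \<longrightarrow> g 1 = e)"
  proof -
    obtain f where f: "bij_betw f {1..card W1} W1" using ex_bij_betw_nat_finite_1[OF fin(1)] by blast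
    show ?thesis
    proof (cases s)
      case (Some e)
      then have e: "e \<in> W1" using wp by (simp add: well_pointed_def)
      then have "1 \<in> {1..card W1}" using fin by (auto simp: Suc_le_eq card_gt_0_iff)
      then have "f 1 \<in> W1" using f by (auto simp: bij_betw_def)
      then have "bij_betw (transpose (f 1) e) W1 W1" using e by simp
      then have "bij_betw (transpose (f 1) e \<circ> f) {1..card W1} W1" by (rule bij_betw_trans[OF f])
      then show ?thesis using Some by (intro exI[of _ "transpose (f 1) e \<circ> f"]) auto
    qed (use f in auto)
  qed
  then obtain g1 where g1: "bij_betw g1 {1..card W1} W1" "\<And>e. s = Some e \<Longrightarrow> g1 1 = e" by blast
  have "card {card W1 + 1..card W2 + card W1} = card W2" by simp
  then obtain g2 where g2: "bij_betw g2 {card W1 + 1..card W2 + card W1} W2"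
    using finite_same_card_bij[of "{card W1 + 1..card W2 + card W1}" W2] fin by blast
  define g where "g i = (if i \<in> {1..card W1} then g1 i else g2 i)" for i
  have b1: "bij_betw g {1..card W1} W1"
    using g1(1) by (subst bij_betw_cong[of _ g g1]) (auto simp: g_def)
  have b2: "bij_betw g {card W1 + 1..card W2 + card W1} W2"
    using g2 by (subst bij_betw_cong[of _ g g2]) (auto simp: g_def)
  let ?s = "\<lambda>v. ({v}, if v \<in> W1 then Some v else None)"
  have "bij_betw g ({1..card W1} \<union> {card W1 + 1..card W2 + card W1}) (W1 \<union> W2)"
    by (rule bij_betw_combine[OF b1 b2 W])
  moreover have "bij_betw ?s (W1 \<union> W2) (singletons W1 W2)"
    by (auto simp: bij_betw_def inj_on_def singletons_def)
  ultimately have "bij_betw (?s \<circ> g) ({1..card W1} \<union> {card W1 + 1..card W2 + card W1})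
      (singletons W1 W2)" by (rule bij_betw_trans)
  moreover have "g i \<in> W1" if "i \<in> {1..card W1}" for i using b1 that by (auto simp: bij_betw_def)
  moreover have "g i \<notin> W1" if "i \<in> {card W1 + 1..card W2 + card W1}" for i
    using b2 that W by (auto simp: bij_betw_def)
  ultimately have "block_labelling {1..card W1} {card W1 + 1..card W2 + card W1} W1 W2
      (singletons W1 W2) (?s \<circ> g)"
    using sp_partition_singletons[OF fin W] W by unfold_locales auto
  moreover have "Option.bind (if s \<noteq> None then Some 1 else None) (\<lambda>i. snd ((?s \<circ> g) i)) = s"
  proof (cases s)
    case (Some e)
    then have e: "e \<in> W1" using wp by (simp add: well_pointed_def)
    then have "1 \<in> {1..card W1}" using fin by (auto simp: Suc_le_eq card_gt_0_iff)
    then have "g 1 = e" using g1(2)[OF Some] by (simp add: g_def)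
    then show ?thesis using Some e by simp
  qed simp
  ultimately show ?thesis by blast
qed

text \<open>\<open>wp\<close> says that the one-block partition with mark \<open>pt\<close> is
  admissible; on the standard ground sets this is what \<open>Pdef\<close> provides.\<close>

locale ground =
  fixes V1 V2 :: "nat set" and pt :: "nat option"
  assumes fin: "finite V1" "finite V2" and disj: "V1 \<inter> V2 = {}"
    and wp: "well_pointed V1 V2 (V1 \<union> V2, pt)"
begin

abbreviation "carr \<equiv> (\<lambda>x. [x]) ` upset V1 V2 pt"

lemma upset_partition: "x \<in> upset V1 V2 pt \<Longrightarrow> sp_partition V1 V2 x"
  by (simp add: upset_def)

lemma singletons_in: "singletons V1 V2 \<in> upset V1 V2 pt"
  using singletons_in_upset[OF fin disj one_block_in_upset[OF disj wp]] .

lemma carr_antisym: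
  "a \<in> carr \<Longrightarrow> b \<in> carr \<Longrightarrow> dle a b \<Longrightarrow> dle b a \<Longrightarrow> a = b"
  using sp_le_antisym upset_partition by fastforce

lemma sp_le_top: "x \<in> upset V1 V2 pt \<Longrightarrow> sp_le {(V1 \<union> V2, pt)} x"
  using sp_le_one_block_iff by (auto simp: upset_def)

lemma bot_of_carr: "bot_of carr = [singletons V1 V2]"
  using singletons_in sp_le_singletons[OF fin disj] carr_antisym
  by (intro bot_of_eqI) (auto simp: upset_def)

lemma top_of_carr: "top_of carr = [{(V1 \<union> V2, pt)}]"
  using one_block_in_upset[OF disj wp] sp_le_top carr_antisym
  by (intro top_of_eqI) auto

text \<open>The block of \<open>x\<close> with mark \<open>pt\<close> contains a block of
  \<open>y\<close> with the same mark, so refining never leaves the up-set.\<close>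

lemma upper_in_upset:
  assumes x: "x \<in> upset V1 V2 pt" and y: "sp_partition V1 V2 y" and "sp_le x y"
  shows "y \<in> upset V1 V2 pt"
proof -
  obtain q where "q \<in> x" "snd q = pt" using x by (auto simp: upset_def)
  then show ?thesis using assms(3) y
    unfolding sp_le_partition_iff[OF upset_partition[OF x] y] upset_def by fastforce
qed

lemma lower_interval:
  assumes x: "x \<in> upset V1 V2 pt"
  shows "intv carr (bot_of carr) [x] = (\<lambda>y. [y]) ` {y. sp_partition V1 V2 y \<and> sp_le x y}"
  using upper_in_upset[OF x] sp_le_singletons[OF fin disj] upset_partition
  unfolding intv_def bot_of_carr by auto

lemma upper_interval:
  "intv carr [x] (top_of carr) = (\<lambda>y. [y]) ` {y \<in> upset V1 V2 pt. sp_le y x}"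
  using sp_le_top unfolding intv_def top_of_carr by auto

lemma intv_antisym:
  "a \<in> intv carr r s \<Longrightarrow> b \<in> intv carr r s \<Longrightarrow> dle a b \<Longrightarrow> dle b a \<Longrightarrow> a = b"
  using carr_antisym unfolding intv_def by blast

lemma bot_of_lower_interval:
  assumes x: "x \<in> upset V1 V2 pt"
  shows "bot_of (intv carr (bot_of carr) [x]) = [singletons V1 V2]"
  by (intro bot_of_eqI intv_antisym; (assumption)?)
     (use sp_le_singletons[OF fin disj] upset_partition[OF x] sp_partition_singletons[OF fin disj]
      in \<open>auto simp: lower_interval[OF x]\<close>)

lemma top_of_lower_interval:
  assumes x: "x \<in> upset V1 V2 pt"
  shows "top_of (intv carr (bot_of carr) [x]) = [x]"
  by (intro top_of_eqI intv_antisym; (assumption)?)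
     (use upset_partition[OF x] sp_le_refl in \<open>auto simp: lower_interval[OF x]\<close>)

lemma bot_of_upper_interval:
  assumes x: "x \<in> upset V1 V2 pt"
  shows "bot_of (intv carr [x] (top_of carr)) = [x]"
  by (intro bot_of_eqI intv_antisym; (assumption)?)
     (use x upset_partition[OF x] sp_le_refl in \<open>auto simp: upper_interval\<close>)

lemma top_of_upper_interval:
  assumes x: "x \<in> upset V1 V2 pt"
  shows "top_of (intv carr [x] (top_of carr)) = [{(V1 \<union> V2, pt)}]"
  by (intro top_of_eqI intv_antisym; (assumption)?)
     (use sp_le_top x one_block_in_upset[OF disj wp] in \<open>auto simp: upper_interval\<close>)

end

section \<open>Refinements of a partition, block by block\<close>

lemma restr_upset:
  assumes disj: "V1 \<inter> V2 = {}" and x: "sp_partition V1 V2 x" and y: "sp_partition V1 V2 y"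
    and le: "sp_le x y" and b: "b \<in> x"
  shows "restr y b \<in> upset (fst b \<inter> V1) (fst b \<inter> V2) (snd b)"
proof -
  note le' = le[unfolded sp_le_partition_iff[OF x y]]
  have d: "(fst b \<inter> V1) \<inter> (fst b \<inter> V2) = {}" using disj by blast
  have "sp_partition (fst b \<inter> V1) (fst b \<inter> V2) (restr y b)"
    unfolding sp_partition_iff[OF d]
  proof (intro conjI ballI)
    show "finite (restr y b)" using sp_partitionD(1)[OF y] by (simp add: restr_def)
    have "\<exists>c\<in>restr y b. v \<in> fst c" if v: "v \<in> fst b" for v
    proof -
      obtain c where c: "c \<in> y" "v \<in> fst c"
        using sp_partitionD(6)[OF y] sp_partitionD(4)[OF x b] v by blast
      then obtain b' where b': "b' \<in> x" "fst c \<subseteq> fst b'" using le' by blast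
      \<comment> \<open>A block of \<open>y\<close> that meets \<open>b\<close> cannot leave it: the
        block of \<open>x\<close> containing it also meets \<open>b\<close>.\<close>
      then have "b' = b" using sp_partitionD(5)[OF x b'(1) b, of v] c v by blast
      then show ?thesis using c b' unfolding restr_def by blast
    qed
    then have "\<Union> (fst ` restr y b) = fst b" by (auto simp: restr_def)
    then show "\<Union> (fst ` restr y b) = fst b \<inter> V1 \<union> fst b \<inter> V2"
      using sp_partitionD(4)[OF x b] by blast
    show "disj_blocks (restr y b)"
      using sp_partition_disj_blocks[OF y] unfolding disj_blocks_def restr_def by simp
    fix c assume "c \<in> restr y b"
    then have "well_pointed V1 V2 c" "fst c \<subseteq> fst b"
      using y by (auto simp: restr_def sp_partition_iff[OF disj])
    then show "well_pointed (fst b \<inter> V1) (fst b \<inter> V2) c"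
      by (auto simp: well_pointed_def split: option.splits)
  qed
  moreover have "\<exists>q\<in>restr y b. snd q = snd b" using le' b unfolding restr_def by blast
  ultimately show ?thesis by (simp add: upset_def)
qed

text \<open>Both conditions in \<open>sp_le\<close> relate a block to subsets of it, and every block
  of a refinement lies in a block of \<open>x\<close>; so they can be tested inside each block of
  \<open>x\<close> separately.\<close>

lemma sp_le_restr_iff:
  assumes disj: "V1 \<inter> V2 = {}" and x: "sp_partition V1 V2 x"
    and y: "sp_partition V1 V2 y" and le: "sp_le x y"
    and y': "sp_partition V1 V2 y'" and le': "sp_le x y'"
  shows "sp_le y y' \<longleftrightarrow> (\<forall>b\<in>x. sp_le (restr y b) (restr y' b))"
proof -
  note ley = le[unfolded sp_le_partition_iff[OF x y]]
  note ley' = le'[unfolded sp_le_partition_iff[OF x y']]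
  have iff: "sp_le (restr y b) (restr y' b) \<longleftrightarrow>
      (\<forall>q\<in>restr y' b. \<exists>c\<in>restr y b. fst q \<subseteq> fst c) \<and>
      (\<forall>c\<in>restr y b. \<exists>q\<in>restr y' b. fst q \<subseteq> fst c \<and> snd q = snd c)" if "b \<in> x" for b
    using restr_upset[OF disj x y le that] restr_upset[OF disj x y' le' that]
    by (intro sp_le_partition_iff) (auto simp: upset_def)
  show ?thesis
  proof
    assume L: "sp_le y y'"
    note L' = L[unfolded sp_le_partition_iff[OF y y']]
    show "\<forall>b\<in>x. sp_le (restr y b) (restr y' b)"
    proof
      fix b assume b: "b \<in> x"
      show "sp_le (restr y b) (restr y' b)" unfolding iff[OF b]
      proof (intro conjI ballI)
        fix q assume "q \<in> restr y' b"
        then have q: "q \<in> y'" "fst q \<subseteq> fst b" by (auto simp: restr_def)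
        then obtain c where c: "c \<in> y" "fst q \<subseteq> fst c" using L' by blast
        then obtain b' where b': "b' \<in> x" "fst c \<subseteq> fst b'" using ley by blast
        obtain v where "v \<in> fst q" using sp_partitionD(3)[OF y' q(1)] by blast
        then have "b' = b" using sp_partitionD(5)[OF x b'(1) b, of v] q c b' by blast
        then show "\<exists>c\<in>restr y b. fst q \<subseteq> fst c" using c b' unfolding restr_def by blast
      next
        fix c assume "c \<in> restr y b"
        then have c: "c \<in> y" "fst c \<subseteq> fst b" by (auto simp: restr_def)
        then obtain q where "q \<in> y'" "fst q \<subseteq> fst c" "snd q = snd c" using L' by blast
        then show "\<exists>q\<in>restr y' b. fst q \<subseteq> fst c \<and> snd q = snd c"
          using c unfolding restr_def by blast
      qed
    qed
  next
    assume R: "\<forall>b\<in>x. sp_le (restr y b) (restr y' b)"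
    show "sp_le y y'" unfolding sp_le_partition_iff[OF y y']
    proof (intro conjI ballI)
      fix q assume q: "q \<in> y'"
      then obtain b where b: "b \<in> x" "fst q \<subseteq> fst b" using ley' by blast
      then have "q \<in> restr y' b" using q by (simp add: restr_def)
      then obtain c where "c \<in> restr y b" "fst q \<subseteq> fst c" using R iff[OF b(1)] b(1) by blast
      then show "\<exists>c\<in>y. fst q \<subseteq> fst c" by (auto simp: restr_def)
    next
      fix c assume c: "c \<in> y"
      then obtain b where b: "b \<in> x" "fst c \<subseteq> fst b" using ley by blast
      then have "c \<in> restr y b" using c by (simp add: restr_def)
      then obtain q where "q \<in> restr y' b" "fst q \<subseteq> fst c" "snd q = snd c"
        using R iff[OF b(1)] b(1) by blast
      then show "\<exists>q\<in>y'. fst q \<subseteq> fst c \<and> snd q = snd c" by (auto simp: restr_def)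
    qed
  qed
qed

text \<open>Inverse of restriction. The mark present in each \<open>w b\<close> puts the union above
  \<open>x\<close>, and disjointness of the blocks of \<open>x\<close> allows each
  \<open>w b\<close> to be recovered.\<close>

lemma glue:
  assumes disj: "V1 \<inter> V2 = {}" and x: "sp_partition V1 V2 x"
    and w: "\<And>b. b \<in> x \<Longrightarrow> w b \<in> upset (fst b \<inter> V1) (fst b \<inter> V2) (snd b)"
  defines "y \<equiv> \<Union>b\<in>x. w b"
  shows "sp_partition V1 V2 y" "sp_le x y" "\<And>b. b \<in> x \<Longrightarrow> restr y b = w b"
proof -
  have wp: "sp_partition (fst b \<inter> V1) (fst b \<inter> V2) (w b)" if "b \<in> x" for b
    using w[OF that] by (simp add: upset_def)
  have d: "(fst b \<inter> V1) \<inter> (fst b \<inter> V2) = {}" for b :: blk using disj by blast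
  have sub: "fst c \<subseteq> fst b" if "b \<in> x" "c \<in> w b" for b c
    using sp_partitionD(4)[OF wp[OF that(1)] that(2)] by blast
  have same: "b = b'" if "b \<in> x" "c \<in> w b" "b' \<in> x" "v \<in> fst c" "v \<in> fst b'" for b b' c v
    using sp_partitionD(5)[OF x that(1) that(3), of v] that sub by blast
  show "\<And>b. b \<in> x \<Longrightarrow> restr y b = w b"
  proof (intro equalityI subsetI)
    fix b c assume b: "b \<in> x" and "c \<in> restr y b"
    then obtain b' where b': "b' \<in> x" "c \<in> w b'" "fst c \<subseteq> fst b" by (auto simp: restr_def y_def)
    obtain v where "v \<in> fst c" using sp_partitionD(3)[OF wp[OF b'(1)] b'(2)] by blast
    then have "b' = b" using same[OF b'(1,2) b, of v] b' by blast
    then show "c \<in> w b" using b' by simp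
  next
    fix b c assume "b \<in> x" "c \<in> w b"
    then show "c \<in> restr y b" using sub by (auto simp: restr_def y_def)
  qed
  show yp: "sp_partition V1 V2 y" unfolding sp_partition_iff[OF disj]
  proof (intro conjI ballI)
    show "finite y" using sp_partitionD(1)[OF x] sp_partitionD(1)[OF wp] by (simp add: y_def)
    have "\<Union> (fst ` y) = (\<Union>b\<in>x. \<Union> (fst ` w b))" by (auto simp: y_def)
    also have "\<dots> = (\<Union>b\<in>x. fst b)"
    proof (intro SUP_cong refl)
      fix b assume "b \<in> x"
      then show "\<Union> (fst ` w b) = fst b"
        using sp_partitionD(2)[OF wp, of b] sp_partitionD(4)[OF x, of b] by blast
    qed
    finally show "\<Union> (fst ` y) = V1 \<union> V2" using sp_partitionD(2)[OF x] by simp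
    show "disj_blocks y" unfolding disj_blocks_def
    proof (intro ballI impI)
      fix c c' assume "c \<in> y" "c' \<in> y" "fst c \<inter> fst c' \<noteq> {}"
      then obtain b b' v where bb: "b \<in> x" "c \<in> w b" "b' \<in> x" "c' \<in> w b'" "v \<in> fst c" "v \<in> fst c'"
        by (auto simp: y_def)
      moreover from this have "b = b'" using same sub by blast
      ultimately show "c = c'" using sp_partitionD(5)[OF wp] by blast
    qed
    fix c assume "c \<in> y"
    then obtain b where b: "b \<in> x" "c \<in> w b" by (auto simp: y_def)
    then have "well_pointed (fst b \<inter> V1) (fst b \<inter> V2) c" using wp sp_partition_iff[OF d] by blast
    then show "well_pointed V1 V2 c" by (auto simp: well_pointed_def split: option.splits)
  qed
  show "sp_le x y" unfolding sp_le_partition_iff[OF x yp]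
  proof (intro conjI ballI)
    fix c assume "c \<in> y"
    then show "\<exists>b\<in>x. fst c \<subseteq> fst b" using sub unfolding y_def by blast
  next
    fix b assume b: "b \<in> x"
    then obtain q where "q \<in> w b" "snd q = snd b" using w[OF b] by (auto simp: upset_def)
    then show "\<exists>q\<in>y. fst q \<subseteq> fst b \<and> snd q = snd b" using sub b unfolding y_def by blast
  qed
qed

section \<open>Isomorphism classes of the intervals of an arranged partition\<close>

text \<open>\<open>sorted\<close> gives the labels 1 to \<open>np\<close> to the pointed blocks, as
  the standard ground set requires. \<open>head\<close> gives label 1 to the block with mark
  \<open>pt\<close> in the pointed case, so that coarsenings with this mark correspond to partitions
  of the labels having a block pointed at 1.\<close>

locale arrangement = ground +
  fixes bs :: "blk list"
  assumes dist: "distinct bs" and bs_upset: "set bs \<in> upset V1 V2 pt"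
    and sorted: "bs = filter (\<lambda>b. snd b \<noteq> None) bs @ filter (\<lambda>b. snd b = None) bs"
    and head: "\<And>e. pt = Some e \<Longrightarrow> snd (hd bs) = Some e"
begin

abbreviation "np \<equiv> length (filter (\<lambda>b. snd b \<noteq> None) bs)"
abbreviation "nu \<equiv> length (filter (\<lambda>b. snd b = None) bs)"
abbreviation "n1 (b :: blk) \<equiv> card (fst b \<inter> V1)"
abbreviation "n2 (b :: blk) \<equiv> card (fst b \<inter> V2)"

lemma x: "sp_partition V1 V2 (set bs)" by (rule upset_partition[OF bs_upset])

lemma length_bs: "length bs = np + nu"
  by (subst sorted) (simp only: length_append)

lemma nth_pointed: "i < np \<Longrightarrow> snd (bs ! i) \<noteq> None"
proof -
  assume i: "i < np"
  then have "filter (\<lambda>b. snd b \<noteq> None) bs ! i \<in> set (filter (\<lambda>b. snd b \<noteq> None) bs)"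
    by (rule nth_mem)
  moreover have "bs ! i = filter (\<lambda>b. snd b \<noteq> None) bs ! i"
    by (subst sorted) (use i in \<open>simp only: nth_append if_True\<close>)
  ultimately show "snd (bs ! i) \<noteq> None" by simp
qed

lemma nth_unpointed: "np \<le> i \<Longrightarrow> i < length bs \<Longrightarrow> snd (bs ! i) = None"
proof -
  assume i: "np \<le> i" "i < length bs"
  then have "i - np < nu" using length_bs by simp
  then have "filter (\<lambda>b. snd b = None) bs ! (i - np) \<in> set (filter (\<lambda>b. snd b = None) bs)"
    by (rule nth_mem)
  moreover have "bs ! i = filter (\<lambda>b. snd b = None) bs ! (i - np)"
    by (subst sorted) (use i in \<open>simp only: nth_append linorder_not_less[symmetric] if_False\<close>)
  ultimately show "snd (bs ! i) = None" by simp
qed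

lemma npointed_x: "npointed [set bs] = np" "nunpointed [set bs] = nu"
  unfolding npointed_single nunpointed_single
  using distinct_card[OF distinct_filter[OF dist]] by simp_all

text \<open>Together with \<open>nu_pos\<close> this ensures that the poset P_{p+q,p,o} attached to
  the arrangement is defined.\<close>

lemma np_pos: "pt \<noteq> None \<Longrightarrow> 1 \<le> np"
proof -
  assume "pt \<noteq> None"
  then obtain q where "q \<in> set bs" "snd q \<noteq> None" using bs_upset by (auto simp: upset_def)
  then have "q \<in> set (filter (\<lambda>b. snd b \<noteq> None) bs)" by simp
  then show ?thesis by (metis length_pos_if_in_set Suc_leI One_nat_def)
qed

lemma nu_pos: "pt = None \<Longrightarrow> 1 \<le> nu"
proof -
  assume "pt = None"
  then obtain q where "q \<in> set bs" "snd q = None" using bs_upset by (auto simp: upset_def)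
  then have "q \<in> set (filter (\<lambda>b. snd b = None) bs)" by simp
  then show ?thesis by (metis length_pos_if_in_set Suc_leI One_nat_def)
qed

text \<open>Numbering the blocks by position labels \<open>set bs\<close> by the standard ground
  set, and \<open>expand\<close> then carries P_{p+q,p,o} onto the coarsenings of
  \<open>set bs\<close> with mark \<open>pt\<close>.\<close>

lemma upper_interval_class:
  assumes ob: "ob = (if pt = None then 0 else 1)"
  shows "cls_eq (intv carr [set bs] (top_of carr)) (Pcar (np + nu) np ob)"
proof -
  let ?A = "{1..np}" and ?B = "{np + 1..np + nu}"
  let ?s = "if ob = 1 then Some 1 else None :: nat option"
  \<comment> \<open>Labels start at 1, list positions at 0.\<close>
  let ?h = "\<lambda>i. bs ! (i - 1)"
  have AB: "?A \<inter> ?B = {}" "?A \<union> ?B = {1..length bs}" using length_bs by auto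
  have bij: "bij_betw ?h (?A \<union> ?B) (set bs)"
  proof -
    have "bij_betw (\<lambda>i. i - 1) {1..length bs} {..<length bs}"
      by (rule bij_betw_byWitness[of _ Suc]) auto
    moreover have "bij_betw ((!) bs) {..<length bs} (set bs)"
      using bij_betw_nth[OF dist] by simp
    ultimately show ?thesis using bij_betw_trans unfolding AB by (fastforce simp: comp_def)
  qed
  interpret L: block_labelling ?A ?B V1 V2 "set bs" ?h
  proof
    show "snd (?h i) \<noteq> None" if "i \<in> ?A" for i using nth_pointed[of "i - 1"] that by fastforce
    show "snd (?h i) = None" if "i \<in> ?B" for i
      using nth_unpointed[of "i - 1"] that length_bs by fastforce
  qed (use AB(1) disj x bij in auto)
  have s: "set_option ?s \<subseteq> ?A" using np_pos ob by auto
  \<comment> \<open>In the pointed case label 1 stands for the first block, whose mark is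
    \<open>pt\<close> by \<open>head\<close>.\<close>
  have bind: "Option.bind ?s (\<lambda>i. snd (?h i)) = pt"
  proof (cases pt)
    case (Some e)
    then have "bs \<noteq> []" using np_pos by fastforce
    then show ?thesis using Some head ob by (simp add: hd_conv_nth)
  qed (simp add: ob)
  interpret G: ground ?A ?B ?s
    using np_pos nu_pos AB(1) ob by unfold_locales (auto simp: well_pointed_def)
  have Pcar: "Pcar (np + nu) np ob = (\<lambda>x. [x]) ` upset ?A ?B ?s"
    by (rule Pcar_eq) simp
  have counts: "npointed (bot_of (Pcar (np + nu) np ob)) = np"
    "nunpointed (bot_of (Pcar (np + nu) np ob)) = nu"
    "npointed (top_of (Pcar (np + nu) np ob)) = (if pt = None then 0 else 1)"
    "nunpointed (top_of (Pcar (np + nu) np ob)) = (if pt = None then 1 else 0)"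
    unfolding Pcar G.bot_of_carr G.top_of_carr npointed_singletons[OF AB(1)] npointed_one_block
    by (simp_all add: ob)
  have "cls_eq (Pcar (np + nu) np ob) (intv carr [set bs] (top_of carr))"
  proof (rule cls_eqI[of "\<lambda>zs. [expand ?h (hd zs)]"])
    show "(\<lambda>zs. [expand ?h (hd zs)]) ` Pcar (np + nu) np ob = intv carr [set bs] (top_of carr)"
      unfolding Pcar upper_interval image_image L.expand_upset[OF s, unfolded bind, symmetric]
      by simp
    show "dle a b \<longleftrightarrow> dle [expand ?h (hd a)] [expand ?h (hd b)]"
      if "a \<in> Pcar (np + nu) np ob" "b \<in> Pcar (np + nu) np ob" for a b
    proof -
      obtain z z' where "a = [z]" "b = [z']" "z \<in> upset ?A ?B ?s" "z' \<in> upset ?A ?B ?s"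
        using \<open>a \<in> _\<close> \<open>b \<in> _\<close> unfolding Pcar by blast
      then show ?thesis using L.expand_le_iff[OF G.upset_partition G.upset_partition] by simp
    qed
    show "dle a a" if "a \<in> Pcar (np + nu) np ob" for a
      using that sp_le_refl[OF G.upset_partition] unfolding Pcar by (elim imageE) simp
    show "a = b" if "a \<in> Pcar (np + nu) np ob" "b \<in> Pcar (np + nu) np ob" "dle a b" "dle b a" for a b
      using that unfolding Pcar by (rule G.carr_antisym)
  qed (simp_all only: counts bot_of_upper_interval[OF bs_upset] top_of_upper_interval[OF bs_upset]
      npointed_x npointed_one_block)
  then show ?thesis by (rule cls_eq_sym)
qed

text \<open>The least element of the product has one component per block, so its pointed and
  unpointed counts are these sums; they have to agree with the counts of the partition into
  singletons.\<close>

lemma sum_n1: "(\<Sum>b\<leftarrow>bs. n1 b) = card V1" and sum_n2: "(\<Sum>b\<leftarrow>bs. n2 b) = card V2"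
proof -
  have "(\<Sum>b\<in>set bs. card (fst b \<inter> W)) = card W" if "W \<subseteq> V1 \<union> V2" for W
  proof -
    have "(\<Union>b\<in>set bs. fst b \<inter> W) = W" using sp_partitionD(2)[OF x] that by blast
    moreover have "finite (fst b \<inter> W)" for b :: blk
      using fin that by (meson finite_Int finite_UnI finite_subset)
    ultimately show ?thesis
      using card_UN_disjoint[of "set bs" "\<lambda>b. fst b \<inter> W"] sp_partitionD(5)[OF x] by fastforce
  qed
  then show "(\<Sum>b\<leftarrow>bs. n1 b) = card V1" "(\<Sum>b\<leftarrow>bs. n2 b) = card V2"
    using dist by (simp_all add: sum_list_distinct_conv_sum_set)
qed

lemma block_ground:
  assumes "b \<in> set bs"
  shows "ground {1..n1 b} {n1 b + 1..n2 b + n1 b} (if snd b \<noteq> None then Some 1 else None)"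
    and "well_pointed (fst b \<inter> V1) (fst b \<inter> V2) (fst b \<inter> V1 \<union> fst b \<inter> V2, snd b)"
    and "snd b \<noteq> None \<Longrightarrow> 1 \<le> n1 b" "snd b = None \<Longrightarrow> 1 \<le> n2 b"
proof -
  show wp': "well_pointed (fst b \<inter> V1) (fst b \<inter> V2) (fst b \<inter> V1 \<union> fst b \<inter> V2, snd b)"
    using x assms by (auto simp: sp_partition_iff[OF disj] well_pointed_def split: option.splits)
  show 1: "1 \<le> n1 b" if "snd b \<noteq> None"
    using wp' fin that by (auto simp: well_pointed_def Suc_le_eq card_gt_0_iff)
  show 2: "1 \<le> n2 b" if "snd b = None"
    using wp' fin disj that by (auto simp: well_pointed_def Suc_le_eq card_gt_0_iff)
  show "ground {1..n1 b} {n1 b + 1..n2 b + n1 b} (if snd b \<noteq> None then Some 1 else None)"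
    using 1 2 by unfold_locales (auto simp: well_pointed_def)
qed

text \<open>A refinement is sent to the list of its restrictions, each pulled back to the standard
  ground set of its block. Surjectivity comes from gluing, and the order is compared
  blockwise.\<close>

lemma lower_interval_class:
  "cls_eq (intv carr (bot_of carr) [set bs])
     (prod_car (map (\<lambda>b. Pcar (n2 b + n1 b) (n1 b) (if snd b \<noteq> None then 1 else 0)) bs))"
proof -
  define s where "s b = (if snd b \<noteq> None then Some 1 else None :: nat option)" for b :: blk
  define A where "A b = {1..n1 b}" for b
  define B where "B b = {n1 b + 1..n2 b + n1 b}" for b
  define U where "U b = upset (A b) (B b) (s b)" for b
  let ?P = "prod_car (map (\<lambda>b. Pcar (n2 b + n1 b) (n1 b) (if snd b \<noteq> None then 1 else 0)) bs)"
  let ?I = "intv carr (bot_of carr) [set bs]"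
  have gr: "ground (A b) (B b) (s b)" if "b \<in> set bs" for b
    using block_ground(1)[OF that] unfolding A_def B_def s_def .
  have "(\<lambda>b. Pcar (n2 b + n1 b) (n1 b) (if snd b \<noteq> None then 1 else 0)) = (\<lambda>b. (\<lambda>x. [x]) ` U b)"
    by (rule ext) (simp add: Pcar_eq U_def A_def B_def s_def)
  then have P: "?P = {map w bs | w. \<forall>b\<in>set bs. w b \<in> U b}"
    using prod_car_singletons[OF dist, of U] by simp
  have "\<forall>b\<in>set bs. \<exists>h. block_labelling (A b) (B b) (fst b \<inter> V1) (fst b \<inter> V2)
      (singletons (fst b \<inter> V1) (fst b \<inter> V2)) h \<and> Option.bind (s b) (\<lambda>i. snd (h i)) = snd b"
    unfolding A_def B_def s_def
    using labelling_exists[OF _ _ _ block_ground(2)] fin disj by (simp add: Int_left_commute Int_assoc)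
  then obtain H where H: "\<And>b. b \<in> set bs \<Longrightarrow> block_labelling (A b) (B b) (fst b \<inter> V1) (fst b \<inter> V2)
      (singletons (fst b \<inter> V1) (fst b \<inter> V2)) (H b)"
    "\<And>b. b \<in> set bs \<Longrightarrow> Option.bind (s b) (\<lambda>i. snd (H b i)) = snd b" by metis
  have img: "expand (H b) ` U b = upset (fst b \<inter> V1) (fst b \<inter> V2) (snd b)" if b: "b \<in> set bs" for b
  proof -
    interpret L: block_labelling "A b" "B b" "fst b \<inter> V1" "fst b \<inter> V2"
      "singletons (fst b \<inter> V1) (fst b \<inter> V2)" "H b" by (rule H(1)[OF b])
    have "set_option (s b) \<subseteq> A b" using block_ground(3)[OF b] by (auto simp: s_def A_def)
    from L.expand_upset[OF this] show ?thesis unfolding H(2)[OF b] U_def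
      using sp_le_singletons[of "fst b \<inter> V1" "fst b \<inter> V2"] fin L.W by (auto simp: upset_def)
  qed
  have ord: "sp_le (expand (H b) z) (expand (H b) z') \<longleftrightarrow> sp_le z z'"
    if "b \<in> set bs" "z \<in> U b" "z' \<in> U b" for b z z'
    using block_labelling.expand_le_iff[OF H(1)[OF that(1)]] that by (auto simp: U_def upset_def)
  have part: "sp_partition (A b) (B b) z" if "z \<in> U b" for b z
    using that by (simp add: U_def upset_def)
  \<comment> \<open>The inverse is meaningful because, by \<open>img\<close>,
    \<open>expand (H b)\<close> reaches every possible restriction to \<open>b\<close>.\<close>
  define K where "K y b = inv_into (U b) (expand (H b)) (restr y b)" for y b
  have K: "K y b \<in> U b" "expand (H b) (K y b) = restr y b"
    if "b \<in> set bs" "sp_partition V1 V2 y" "sp_le (set bs) y" for y b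
    using restr_upset[OF disj x that(2,3,1)] unfolding K_def img[OF that(1), symmetric]
    by (rule inv_into_into f_inv_into_f)+
  have I: "?I = (\<lambda>y. [y]) ` {y. sp_partition V1 V2 y \<and> sp_le (set bs) y}"
    by (rule lower_interval[OF bs_upset])
  have P_antisym: "a = b" if "a \<in> ?P" "b \<in> ?P" "dle a b" "dle b a" for a b
  proof -
    obtain v w where vw: "a = map v bs" "b = map w bs" "\<And>c. c \<in> set bs \<Longrightarrow> v c \<in> U c \<and> w c \<in> U c"
      using \<open>a \<in> ?P\<close> \<open>b \<in> ?P\<close> unfolding P by blast
    have "v c = w c" if "c \<in> set bs" for c
      using \<open>dle a b\<close> \<open>dle b a\<close> vw(3)[OF that] that sp_le_antisym[OF part part]
      unfolding vw(1,2) dle_map_iff by blast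
    then show ?thesis using vw by simp
  qed
  have botP: "bot_of ?P = map (\<lambda>b. singletons (A b) (B b)) bs"
  proof (rule bot_of_eqI[OF _ _ P_antisym])
    show "map (\<lambda>b. singletons (A b) (B b)) bs \<in> ?P"
      using ground.singletons_in[OF gr] unfolding P U_def by blast
    show "dle (map (\<lambda>b. singletons (A b) (B b)) bs) y" if "y \<in> ?P" for y
    proof -
      obtain w where w: "y = map w bs" "\<And>b. b \<in> set bs \<Longrightarrow> w b \<in> U b" using \<open>y \<in> ?P\<close> unfolding P by blast
      show ?thesis unfolding w(1) dle_map_iff
        using sp_le_singletons[OF ground.fin[OF gr] ground.disj[OF gr] part[OF w(2)]] by blast
    qed
  qed
  have topP: "top_of ?P = map (\<lambda>b. {(A b \<union> B b, s b)}) bs"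
  proof (rule top_of_eqI[OF _ _ P_antisym])
    show "map (\<lambda>b. {(A b \<union> B b, s b)}) bs \<in> ?P"
      using one_block_in_upset[OF ground.disj[OF gr] ground.wp[OF gr]] unfolding P U_def by blast
    show "dle y (map (\<lambda>b. {(A b \<union> B b, s b)}) bs)" if "y \<in> ?P" for y
    proof -
      obtain w where w: "y = map w bs" "\<And>b. b \<in> set bs \<Longrightarrow> w b \<in> U b" using \<open>y \<in> ?P\<close> unfolding P by blast
      show ?thesis unfolding w(1) dle_map_iff
        using ground.sp_le_top[OF gr w(2)[unfolded U_def]] by blast
    qed
  qed
  have npmap: "npointed (map f bs) = (\<Sum>b\<leftarrow>bs. npointed [f b])"
    "nunpointed (map f bs) = (\<Sum>b\<leftarrow>bs. nunpointed [f b])" for f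
    by (simp_all add: npointed_def nunpointed_def comp_def)
  have AB: "A b \<inter> B b = {}" for b by (auto simp: A_def B_def)
  have botc: "npointed (bot_of ?P) = card V1" "nunpointed (bot_of ?P) = card V2"
    unfolding botP npmap npointed_singletons[OF AB] using sum_n1 sum_n2
    by (simp_all add: A_def B_def)
  have "npointed (map f bs) = np" "nunpointed (map f bs) = nu"
    if "\<And>b. f b = {(A b \<union> B b, s b)}" for f
  proof -
    have "npointed [f b] = (if snd b \<noteq> None then 1 else 0)"
      "nunpointed [f b] = (if snd b = None then 1 else 0)" for b
      by (simp_all add: npointed_one_block that s_def)
    moreover have "(\<Sum>b\<leftarrow>cs. if Q b then 1 else 0 :: nat) = length (filter Q cs)"
      for Q and cs :: "blk list" by (induction cs) auto
    ultimately show "npointed (map f bs) = np" "nunpointed (map f bs) = nu"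
      unfolding npmap by simp_all
  qed
  then have topc: "npointed (top_of ?P) = np" "nunpointed (top_of ?P) = nu"
    unfolding topP by auto
  show ?thesis
  proof (rule cls_eqI[of "\<lambda>ys. map (K (hd ys)) bs"])
    show "(\<lambda>ys. map (K (hd ys)) bs) ` ?I = ?P"
    proof (intro equalityI subsetI)
      fix a assume "a \<in> (\<lambda>ys. map (K (hd ys)) bs) ` ?I"
      then show "a \<in> ?P" using K(1) unfolding I P by auto
    next
      fix a assume "a \<in> ?P"
      then obtain w where w: "a = map w bs" "\<And>b. b \<in> set bs \<Longrightarrow> w b \<in> U b" unfolding P by blast
      let ?y = "\<Union>b\<in>set bs. expand (H b) (w b)"
      have e: "expand (H b) (w b) \<in> upset (fst b \<inter> V1) (fst b \<inter> V2) (snd b)" if "b \<in> set bs" for b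
        using img[OF that] w(2)[OF that] by blast
      have y: "sp_partition V1 V2 ?y" "sp_le (set bs) ?y"
        "\<And>b. b \<in> set bs \<Longrightarrow> restr ?y b = expand (H b) (w b)"
        by (rule glue[OF disj x e]; assumption)+
      \<comment> \<open>\<open>expand (H b)\<close> reflects the order, so elements with equal
        images are comparable both ways, and antisymmetry yields injectivity.\<close>
      have "K ?y b = w b" if b: "b \<in> set bs" for b
      proof -
        have "expand (H b) (K ?y b) = expand (H b) (w b)"
          using K(2)[OF b y(1,2)] y(3)[OF b] by simp
        moreover have "sp_le z z" if "z \<in> U b" for z using sp_le_refl part that by blast
        ultimately have "sp_le (K ?y b) (w b)" "sp_le (w b) (K ?y b)"
          using ord[OF b K(1)[OF b y(1,2)] w(2)[OF b]] ord[OF b w(2)[OF b] K(1)[OF b y(1,2)]]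
            ord[OF b w(2)[OF b] w(2)[OF b]] w(2)[OF b] by simp_all
        then show ?thesis using sp_le_antisym[OF part part] K(1)[OF b y(1,2)] w(2)[OF b] by blast
      qed
      then have "a = map (K (hd [?y])) bs" using w by simp
      then show "a \<in> (\<lambda>ys. map (K (hd ys)) bs) ` ?I" using y(1,2) unfolding I by blast
    qed
    show "dle a b \<longleftrightarrow> dle (map (K (hd a)) bs) (map (K (hd b)) bs)" if "a \<in> ?I" "b \<in> ?I" for a b
    proof -
      obtain y y' where y: "a = [y]" "sp_partition V1 V2 y" "sp_le (set bs) y"
        and y': "b = [y']" "sp_partition V1 V2 y'" "sp_le (set bs) y'"
        using \<open>a \<in> ?I\<close> \<open>b \<in> ?I\<close> unfolding I by blast
      have "dle a b \<longleftrightarrow> (\<forall>b\<in>set bs. sp_le (restr y' b) (restr y b))"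
        using sp_le_restr_iff[OF disj x y'(2,3) y(2,3)] y(1) y'(1) by simp
      also have "\<dots> \<longleftrightarrow> (\<forall>b\<in>set bs. sp_le (K y' b) (K y b))"
        using ord[OF _ K(1) K(1)] K(2) y(2,3) y'(2,3) by metis
      finally show ?thesis using y(1) y'(1) by (simp add: dle_map_iff)
    qed
    show "dle a a" if "a \<in> ?I" for a using that sp_le_refl unfolding I by auto
    show "a = b" if "a \<in> ?I" "b \<in> ?I" "dle a b" "dle b a" for a b
      using that by (rule intv_antisym)
  qed (simp_all only: botc topc bot_of_lower_interval[OF bs_upset] top_of_lower_interval[OF bs_upset]
      npointed_x npointed_singletons[OF disj])
qed

end

section \<open>Ordered partitions with prescribed block sizes\<close>

text \<open>The flag decides between the factors P_{l_i+k_i,k_i,1} and P_{l_i+k_i,k_i,0}; the next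
  two entries are the l_i and k_i of the theorem, in this order.\<close>

definition block_type :: "nat set \<Rightarrow> nat set \<Rightarrow> blk \<Rightarrow> bool \<times> nat \<times> nat" where
  "block_type V1 V2 b = (snd b \<noteq> None, card (fst b \<inter> V2), card (fst b \<inter> V1))"

definition ordered_partitions :: "nat set \<Rightarrow> nat set \<Rightarrow> (bool \<times> nat \<times> nat) list \<Rightarrow> blk list set" where
  "ordered_partitions V1 V2 ts =
     {bs. distinct bs \<and> sp_partition V1 V2 (set bs) \<and> map (block_type V1 V2) bs = ts}"

definition blocks_of_type :: "nat set \<Rightarrow> nat set \<Rightarrow> bool \<times> nat \<times> nat \<Rightarrow> blk set" where
  "blocks_of_type V1 V2 t =
     {b. fst b \<subseteq> V1 \<union> V2 \<and> well_pointed V1 V2 b \<and> block_type V1 V2 b = t}"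

text \<open>The denominator l_i! (k_i - 1)! of a pointed block, or l_i! k_i! of an unpointed
  one.\<close>

definition type_weight :: "bool \<times> nat \<times> nat \<Rightarrow> nat" where
  "type_weight t = (case t of (p, l, k) \<Rightarrow> fact l * fact (k - of_bool p))"

text \<open>Splitting off the first block is the recursion behind all the counts. The other blocks
  avoid \<open>fst b\<close>, so deleting this set from \<open>V1\<close> and \<open>V2\<close> does
  not affect whether they are well pointed.\<close>

lemma sp_partition_insert_iff:
  assumes disj: "V1 \<inter> V2 = {}"
  shows "distinct (b # bs) \<and> sp_partition V1 V2 (set (b # bs)) \<longleftrightarrow>
    fst b \<subseteq> V1 \<union> V2 \<and> well_pointed V1 V2 b \<and>
    distinct bs \<and> sp_partition (V1 - fst b) (V2 - fst b) (set bs)" (is "?L \<longleftrightarrow> ?R")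
proof -
  have disj': "(V1 - fst b) \<inter> (V2 - fst b) = {}" using disj by blast
  show ?thesis
  proof
    assume L: ?L
    then have P: "sp_partition V1 V2 (set (b # bs))" and d: "b \<notin> set bs" by auto
    have b: "b \<in> set (b # bs)" by simp
    have dj: "fst b \<inter> fst c = {}" if "c \<in> set bs" for c
      using sp_partitionD(5)[OF P b, of c] that d by fastforce
    have wp: "well_pointed V1 V2 c" if "c \<in> set (b # bs)" for c
      using P that unfolding sp_partition_iff[OF disj] by blast
    have "sp_partition (V1 - fst b) (V2 - fst b) (set bs)" unfolding sp_partition_iff[OF disj']
    proof (intro conjI ballI)
      have "fst b \<union> \<Union> (fst ` set bs) = V1 \<union> V2" using sp_partitionD(2)[OF P] by simp
      then show "\<Union> (fst ` set bs) = V1 - fst b \<union> (V2 - fst b)" using dj by blast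
      show "disj_blocks (set bs)"
        using sp_partition_disj_blocks[OF P] unfolding disj_blocks_def by simp
      fix c assume "c \<in> set bs"
      then show "well_pointed (V1 - fst b) (V2 - fst b) c"
        using wp[of c] dj[of c] by (auto simp: well_pointed_def split: option.splits)
    qed simp
    then show ?R using wp[OF b] sp_partitionD(4)[OF P b] L by simp
  next
    assume R: ?R
    then have P: "sp_partition (V1 - fst b) (V2 - fst b) (set bs)" by blast
    have dj: "fst b \<inter> fst c = {}" if "c \<in> set bs" for c
      using sp_partitionD(4)[OF P that] by blast
    have ne: "fst b \<noteq> {}" using R well_pointed_nonempty by blast
    then have "b \<notin> set bs" using dj by blast
    moreover have "sp_partition V1 V2 (set (b # bs))" unfolding sp_partition_iff[OF disj]
    proof (intro conjI ballI)
      show "\<Union> (fst ` set (b # bs)) = V1 \<union> V2" using sp_partitionD(2)[OF P] R by auto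
      show "disj_blocks (set (b # bs))"
        using sp_partition_disj_blocks[OF P] dj unfolding disj_blocks_def by (simp add: Int_commute)
      fix c assume c: "c \<in> set (b # bs)"
      show "well_pointed V1 V2 c"
      proof (cases "c = b")
        case False
        then have "well_pointed (V1 - fst b) (V2 - fst b) c"
          using P c unfolding sp_partition_iff[OF disj'] by simp
        then show ?thesis by (auto simp: well_pointed_def split: option.splits)
      qed (use R in simp)
    qed simp
    ultimately show ?L using R by simp
  qed
qed

text \<open>The remaining blocks avoid \<open>fst b\<close>, so they have the same type over the
  full and over the reduced ground set.\<close>

lemma Cons_in_ordered_partitions_iff:
  assumes disj: "V1 \<inter> V2 = {}"
  shows "b # bs \<in> ordered_partitions V1 V2 (t # ts) \<longleftrightarrow>
    b \<in> blocks_of_type V1 V2 t \<and> bs \<in> ordered_partitions (V1 - fst b) (V2 - fst b) ts"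
proof -
  have "map (block_type V1 V2) bs = map (block_type (V1 - fst b) (V2 - fst b)) bs"
    if P: "sp_partition (V1 - fst b) (V2 - fst b) (set bs)"
  proof (rule map_cong[OF refl])
    fix c assume "c \<in> set bs"
    then have "fst c \<inter> fst b = {}" using sp_partitionD(4)[OF P] by blast
    then have "fst c \<inter> V1 = fst c \<inter> (V1 - fst b)" "fst c \<inter> V2 = fst c \<inter> (V2 - fst b)" by blast+
    then show "block_type V1 V2 c = block_type (V1 - fst b) (V2 - fst b) c"
      by (simp add: block_type_def)
  qed
  then show ?thesis using sp_partition_insert_iff[OF disj, of b bs]
    unfolding ordered_partitions_def blocks_of_type_def mem_Collect_eq list.map list.inject by metis
qed

lemma ordered_partitions_Cons:
  assumes disj: "V1 \<inter> V2 = {}"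
  shows "ordered_partitions V1 V2 (t # ts) = (\<lambda>(b, bs). b # bs) `
    (SIGMA b:blocks_of_type V1 V2 t. ordered_partitions (V1 - fst b) (V2 - fst b) ts)"
    (is "_ = ?f ` ?S")
proof (intro equalityI subsetI)
  fix cs assume cs: "cs \<in> ordered_partitions V1 V2 (t # ts)"
  then obtain b bs where c: "cs = b # bs" by (cases cs) (auto simp: ordered_partitions_def)
  have "(b, bs) \<in> ?S" using cs unfolding c Cons_in_ordered_partitions_iff[OF disj] by simp
  then show "cs \<in> ?f ` ?S" unfolding c by (rule rev_image_eqI) simp
next
  fix cs assume "cs \<in> ?f ` ?S"
  then obtain b bs where "cs = b # bs" "(b, bs) \<in> ?S" by (elim imageE) auto
  then show "cs \<in> ordered_partitions V1 V2 (t # ts)"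
    using Cons_in_ordered_partitions_iff[OF disj] by simp
qed

lemma finite_blocks_of_type:
  assumes "finite V1" "finite V2"
  shows "finite (blocks_of_type V1 V2 t)"
proof (rule finite_subset)
  show "blocks_of_type V1 V2 t \<subseteq> Pow (V1 \<union> V2) \<times> insert None (Some ` V1)"
  proof
    fix b assume "b \<in> blocks_of_type V1 V2 t"
    then show "b \<in> Pow (V1 \<union> V2) \<times> insert None (Some ` V1)"
      by (cases b; cases "snd b") (auto simp: blocks_of_type_def well_pointed_def)
  qed
qed (use assms in simp)

lemma finite_ordered_partitions:
  assumes "finite V1" "finite V2" "V1 \<inter> V2 = {}"
  shows "finite (ordered_partitions V1 V2 ts)"
  using assms
proof (induction ts arbitrary: V1 V2)
  case Nil
  have "ordered_partitions V1 V2 [] \<subseteq> {[]}" by (auto simp: ordered_partitions_def)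
  then show ?case by (rule finite_subset) simp
next
  case (Cons t ts)
  have "finite (ordered_partitions (V1 - fst b) (V2 - fst b) ts)" for b :: blk
    using Cons.prems by (intro Cons.IH) auto
  then show ?case unfolding ordered_partitions_Cons[OF Cons.prems(3)]
    by (intro finite_imageI finite_SigmaI finite_blocks_of_type Cons.prems)
qed

section \<open>Number of blocks of a given type\<close>

lemma card_subsets_containing:
  assumes "finite V" "e \<in> V" "1 \<le> k"
  shows "card {A. A \<subseteq> V \<and> e \<in> A \<and> card A = k} = (card V - 1) choose (k - 1)"
proof -
  have "bij_betw (insert e) {A. A \<subseteq> V - {e} \<and> card A = k - 1} {A. A \<subseteq> V \<and> e \<in> A \<and> card A = k}"
  proof (rule bij_betw_byWitness[of _ "\<lambda>A. A - {e}"])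
    show "insert e ` {A. A \<subseteq> V - {e} \<and> card A = k - 1} \<subseteq> {A. A \<subseteq> V \<and> e \<in> A \<and> card A = k}"
    proof (intro subsetI, elim imageE)
      fix B A assume A: "A \<in> {A. A \<subseteq> V - {e} \<and> card A = k - 1}" "B = insert e A"
      then have "finite A" using assms(1) by (auto intro: finite_subset)
      then show "B \<in> {A. A \<subseteq> V \<and> e \<in> A \<and> card A = k}" using A assms by (auto simp: card_insert_if)
    qed
  qed (use assms in \<open>auto simp: card_Diff_singleton_if\<close>)
  then show ?thesis
    using bij_betw_same_card n_subsets[of "V - {e}" "k - 1"] assms by fastforce
qed

lemma union_Int_parts:
  assumes "V1 \<inter> V2 = {}" "A \<subseteq> V1" "B \<subseteq> V2"
  shows "(A \<union> B) \<inter> V1 = A" "(A \<union> B) \<inter> V2 = B"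
  using assms by blast+

text \<open>Such a block amounts to a \<open>k\<close>-subset of \<open>V1\<close> through
  \<open>e\<close> and an \<open>l\<close>-subset of \<open>V2\<close>, chosen
  independently.\<close>

lemma card_blocks_pointed_at:
  assumes fin: "finite V1" "finite V2" and disj: "V1 \<inter> V2 = {}" and e: "e \<in> V1" and k: "1 \<le> k"
  shows "card {b \<in> blocks_of_type V1 V2 (True, l, k). snd b = Some e} =
    ((card V1 - 1) choose (k - 1)) * (card V2 choose l)"
proof -
  let ?X = "{A. A \<subseteq> V1 \<and> e \<in> A \<and> card A = k} \<times> {B. B \<subseteq> V2 \<and> card B = l}"
  let ?Y = "{b \<in> blocks_of_type V1 V2 (True, l, k). snd b = Some e}"
  have "bij_betw (\<lambda>(A, B). (A \<union> B, Some e)) ?X ?Y"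
  proof (rule bij_betw_byWitness[of _ "\<lambda>b. (fst b \<inter> V1, fst b \<inter> V2)"])
    show "\<forall>a\<in>?X. (fst (case a of (A, B) \<Rightarrow> (A \<union> B, Some e)) \<inter> V1,
        fst (case a of (A, B) \<Rightarrow> (A \<union> B, Some e)) \<inter> V2) = a"
      using union_Int_parts[OF disj] by auto
    show "\<forall>b\<in>?Y. (case (fst b \<inter> V1, fst b \<inter> V2) of (A, B) \<Rightarrow> (A \<union> B, Some e)) = b"
      by (auto simp: blocks_of_type_def)
    show "(\<lambda>(A, B). (A \<union> B, Some e)) ` ?X \<subseteq> ?Y"
      using union_Int_parts[OF disj] e
      by (auto simp: blocks_of_type_def block_type_def well_pointed_def)
    show "(\<lambda>b. (fst b \<inter> V1, fst b \<inter> V2)) ` ?Y \<subseteq> ?X"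
      by (auto simp: blocks_of_type_def block_type_def well_pointed_def)
  qed
  then have "card ?Y = card ?X" by (rule bij_betw_same_card[symmetric])
  then show ?thesis
    using card_subsets_containing[OF fin(1) e k] n_subsets[OF fin(2)]
    by (simp add: card_cartesian_product)
qed

text \<open>The assumption on \<open>l\<close> makes every such block meet \<open>V2\<close>, so
  that it may be left unpointed.\<close>

lemma card_blocks_unpointed:
  assumes fin: "finite V1" "finite V2" and disj: "V1 \<inter> V2 = {}" and l: "1 \<le> l"
  shows "card (blocks_of_type V1 V2 (False, l, k)) = (card V1 choose k) * (card V2 choose l)"
proof -
  let ?X = "{A. A \<subseteq> V1 \<and> card A = k} \<times> {B. B \<subseteq> V2 \<and> card B = l}"
  let ?Y = "blocks_of_type V1 V2 (False, l, k)"
  have "bij_betw (\<lambda>(A, B). (A \<union> B, None)) ?X ?Y"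
  proof (rule bij_betw_byWitness[of _ "\<lambda>b. (fst b \<inter> V1, fst b \<inter> V2)"])
    show "\<forall>a\<in>?X. (fst (case a of (A, B) \<Rightarrow> (A \<union> B, None)) \<inter> V1,
        fst (case a of (A, B) \<Rightarrow> (A \<union> B, None)) \<inter> V2) = a"
      using union_Int_parts[OF disj] by auto
    show "\<forall>b\<in>?Y. (case (fst b \<inter> V1, fst b \<inter> V2) of (A, B) \<Rightarrow> (A \<union> B, None)) = b"
      by (auto simp: blocks_of_type_def block_type_def)
    show "(\<lambda>(A, B). (A \<union> B, None)) ` ?X \<subseteq> ?Y"
      using union_Int_parts[OF disj] l
      by (auto simp: blocks_of_type_def block_type_def well_pointed_def)
    show "(\<lambda>b. (fst b \<inter> V1, fst b \<inter> V2)) ` ?Y \<subseteq> ?X"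
      by (auto simp: blocks_of_type_def block_type_def)
  qed
  then have "card ?Y = card ?X" by (rule bij_betw_same_card[symmetric])
  then show ?thesis using n_subsets[OF fin(1)] n_subsets[OF fin(2)]
    by (simp add: card_cartesian_product)
qed

lemma card_blocks_pointed:
  assumes fin: "finite V1" "finite V2" and disj: "V1 \<inter> V2 = {}" and k: "1 \<le> k"
  shows "card (blocks_of_type V1 V2 (True, l, k)) =
    card V1 * ((card V1 - 1) choose (k - 1)) * (card V2 choose l)"
proof -
  let ?Y = "\<lambda>e. {b \<in> blocks_of_type V1 V2 (True, l, k). snd b = Some e}"
  have "blocks_of_type V1 V2 (True, l, k) = (\<Union>e\<in>V1. ?Y e)"
    by (auto simp: blocks_of_type_def block_type_def well_pointed_def)
  also have "card \<dots> = (\<Sum>e\<in>V1. card (?Y e))"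
    using fin finite_blocks_of_type[OF fin] by (intro card_UN_disjoint) auto
  also have "\<dots> = card V1 * ((card V1 - 1) choose (k - 1)) * (card V2 choose l)"
    using card_blocks_pointed_at[OF fin disj _ k] by simp
  finally show ?thesis .
qed

definition valid_type :: "bool \<times> nat \<times> nat \<Rightarrow> bool" where
  "valid_type t = (case t of (p, l, k) \<Rightarrow> if p then 1 \<le> k else 1 \<le> l)"

lemma fact_choose: "k \<le> n \<Longrightarrow> (n choose k) * fact k * fact (n - k) = (fact n :: nat)"
  using binomial_fact_lemma[of k n] by (simp add: mult_ac)

text \<open>One step of a telescoping product: the number of first blocks times their weight turns
  the factorials of the remaining sizes into those of the full sizes. For a pointed block the choice
  of the point contributes \<open>card V1\<close>, and n times (n-1 choose k-1) (k-1)! (n-k)! is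
  n!.\<close>

lemma card_blocks_of_type_weight:
  assumes fin: "finite V1" "finite V2" and disj: "V1 \<inter> V2 = {}" and t: "t = (p, l, k)"
    and v: "valid_type t" and le: "k \<le> card V1" "l \<le> card V2"
  shows "card (blocks_of_type V1 V2 t) * type_weight t * (fact (card V1 - k) * fact (card V2 - l)) =
    fact (card V1) * fact (card V2)"
proof (cases p)
  case False
  then have "1 \<le> l" using v t by (simp add: valid_type_def)
  then have "card (blocks_of_type V1 V2 t) * type_weight t * (fact (card V1 - k) * fact (card V2 - l)) =
     ((card V1 choose k) * fact k * fact (card V1 - k)) * ((card V2 choose l) * fact l * fact (card V2 - l))"
    using False by (simp add: t card_blocks_unpointed[OF fin disj] type_weight_def mult_ac)
  then show ?thesis by (simp only: fact_choose le)
next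
  case True
  then have k: "1 \<le> k" using v t by (simp add: valid_type_def)
  have "card (blocks_of_type V1 V2 t) * type_weight t * (fact (card V1 - k) * fact (card V2 - l)) =
     card V1 * (((card V1 - 1) choose (k - 1)) * fact (k - 1) * fact ((card V1 - 1) - (k - 1))) *
     ((card V2 choose l) * fact l * fact (card V2 - l))"
    using True k by (simp add: t card_blocks_pointed[OF fin disj] type_weight_def mult_ac)
  also have "\<dots> = card V1 * fact (card V1 - 1) * fact (card V2)"
    using le k by (simp only: fact_choose diff_le_mono)
  also have "card V1 * fact (card V1 - 1) = (fact (card V1) :: nat)"
    using le k fact_reduce[of "card V1", where 'a = nat] by simp
  finally show ?thesis .
qed

lemma card_ordered_partitions_head:
  assumes fin: "finite V1" "finite V2" and disj: "V1 \<inter> V2 = {}"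
    and S: "S \<subseteq> blocks_of_type V1 V2 (p, l, k)"
    and rest: "\<And>b. b \<in> S \<Longrightarrow>
      card (ordered_partitions (V1 - fst b) (V2 - fst b) ts) * w =
      fact (card V1 - k) * fact (card V2 - l)"
  shows "card {bs \<in> ordered_partitions V1 V2 ((p, l, k) # ts). hd bs \<in> S} * w =
    card S * (fact (card V1 - k) * fact (card V2 - l))"
proof -
  let ?R = "\<lambda>b. ordered_partitions (V1 - fst b) (V2 - fst b) ts"
  have eq: "{bs \<in> ordered_partitions V1 V2 ((p, l, k) # ts). hd bs \<in> S} =
      (\<lambda>(b, bs). b # bs) ` (SIGMA b:S. ?R b)"
    using S unfolding ordered_partitions_Cons[OF disj] by (auto simp: image_iff)
  have "finite S" using finite_blocks_of_type[OF fin] S by (rule finite_subset[rotated])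
  moreover have "finite (?R b)" for b :: blk
    using fin disj by (intro finite_ordered_partitions) auto
  ultimately have "card (SIGMA b:S. ?R b) = (\<Sum>b\<in>S. card (?R b))" by (intro card_SigmaI) auto
  moreover have "card ((\<lambda>(b, bs). b # bs) ` (SIGMA b:S. ?R b)) = card (SIGMA b:S. ?R b)"
    by (rule card_image) (auto simp: inj_on_def)
  ultimately have "card {bs \<in> ordered_partitions V1 V2 ((p, l, k) # ts). hd bs \<in> S} * w =
      (\<Sum>b\<in>S. card (?R b) * w)" unfolding eq by (simp add: sum_distrib_right)
  also have "\<dots> = (\<Sum>b\<in>S. fact (card V1 - k) * fact (card V2 - l))"
    by (rule sum.cong[OF refl rest])
  finally show ?thesis by simp
qed

lemma blocks_of_type_card:
  assumes fin: "finite V1" "finite V2" and b: "b \<in> blocks_of_type V1 V2 (p, l, k)"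
  shows "card (V1 - fst b) = card V1 - k" "card (V2 - fst b) = card V2 - l"
    "k \<le> card V1" "l \<le> card V2"
proof -
  have c: "card (fst b \<inter> V1) = k" "card (fst b \<inter> V2) = l"
    using b by (auto simp: blocks_of_type_def block_type_def)
  show "card (V1 - fst b) = card V1 - k" "card (V2 - fst b) = card V2 - l"
    using card_Diff_subset_Int[of V1 "fst b"] card_Diff_subset_Int[of V2 "fst b"] fin c
    by (simp_all add: Int_commute)
  show "k \<le> card V1" "l \<le> card V2"
    using card_mono[OF fin(1), of "fst b \<inter> V1"] card_mono[OF fin(2), of "fst b \<inter> V2"] c by auto
qed

text \<open>A multinomial count: the factorials telescope as blocks are split off. The product form
  keeps it within the natural numbers.\<close>

lemma card_ordered_partitions:
  assumes "finite V1" "finite V2" "V1 \<inter> V2 = {}" "\<forall>t\<in>set ts. valid_type t"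
    and "(\<Sum>t\<leftarrow>ts. snd (snd t)) = card V1" "(\<Sum>t\<leftarrow>ts. fst (snd t)) = card V2"
  shows "card (ordered_partitions V1 V2 ts) * prod_list (map type_weight ts) =
    fact (card V1) * fact (card V2)"
  using assms
proof (induction ts arbitrary: V1 V2)
  case Nil
  then have "V1 = {}" "V2 = {}" by auto
  then have "ordered_partitions V1 V2 [] = {[]}"
    by (auto simp: ordered_partitions_def sp_partition_def)
  then show ?case using \<open>V1 = {}\<close> \<open>V2 = {}\<close> by simp
next
  case (Cons t ts)
  obtain p l k where t: "t = (p, l, k)" by (cases t)
  have le: "k \<le> card V1" "l \<le> card V2" using Cons.prems(5,6) by (simp_all add: t)
  let ?S = "blocks_of_type V1 V2 (p, l, k)"
  have rest: "card (ordered_partitions (V1 - fst b) (V2 - fst b) ts) * prod_list (map type_weight ts) =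
      fact (card V1 - k) * fact (card V2 - l)" if "b \<in> ?S" for b
  proof -
    note c = blocks_of_type_card[OF Cons.prems(1,2) that]
    show ?thesis unfolding c(1,2)[symmetric]
      by (rule Cons.IH) (use Cons.prems c in \<open>auto simp: t\<close>)
  qed
  have "{bs \<in> ordered_partitions V1 V2 ((p, l, k) # ts). hd bs \<in> ?S} =
      ordered_partitions V1 V2 (t # ts)"
  proof -
    have "hd cs \<in> ?S" if "cs \<in> ordered_partitions V1 V2 ((p, l, k) # ts)" for cs
      using that Cons_in_ordered_partitions_iff[OF Cons.prems(3)]
      by (cases cs) (auto simp: ordered_partitions_def)
    then show ?thesis unfolding t by blast
  qed
  then have "card (ordered_partitions V1 V2 (t # ts)) * prod_list (map type_weight ts) =
      card ?S * (fact (card V1 - k) * fact (card V2 - l))"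
    using card_ordered_partitions_head[where S = ?S, OF Cons.prems(1-3) subset_refl rest] by metis
  then have "card (ordered_partitions V1 V2 (t # ts)) * prod_list (map type_weight (t # ts)) =
      card ?S * type_weight t * (fact (card V1 - k) * fact (card V2 - l))"
    by (simp add: mult_ac)
  also have "\<dots> = fact (card V1) * fact (card V2)"
    using card_blocks_of_type_weight[OF Cons.prems(1-3) t _ le] Cons.prems(4) t by simp
  finally show ?case .
qed

text \<open>Only the first block is restricted. Prescribing its point drops the factor
  \<open>card V1\<close> that a free choice would contribute; this is the origin of (k-o)! for o =
  1.\<close>

lemma card_ordered_partitions_pointed_head:
  assumes fin: "finite V1" "finite V2" and disj: "V1 \<inter> V2 = {}" and e: "e \<in> V1"
    and ts: "\<forall>t\<in>set ts. valid_type t" and k: "1 \<le> k"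
    and sum: "k + (\<Sum>t\<leftarrow>ts. snd (snd t)) = card V1" "l + (\<Sum>t\<leftarrow>ts. fst (snd t)) = card V2"
  shows "card {bs \<in> ordered_partitions V1 V2 ((True, l, k) # ts). snd (hd bs) = Some e} *
      prod_list (map type_weight ((True, l, k) # ts)) = fact (card V1 - 1) * fact (card V2)"
proof -
  have le: "k \<le> card V1" "l \<le> card V2" using sum by auto
  let ?S = "{b \<in> blocks_of_type V1 V2 (True, l, k). snd b = Some e}"
  have rest: "card (ordered_partitions (V1 - fst b) (V2 - fst b) ts) * prod_list (map type_weight ts) =
      fact (card V1 - k) * fact (card V2 - l)" if "b \<in> ?S" for b
  proof -
    have "b \<in> blocks_of_type V1 V2 (True, l, k)" using that by simp
    note c = blocks_of_type_card[OF fin this]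
    show ?thesis unfolding c(1,2)[symmetric]
      by (rule card_ordered_partitions) (use fin disj ts sum c in auto)
  qed
  have eq: "{bs \<in> ordered_partitions V1 V2 ((True, l, k) # ts). hd bs \<in> ?S} =
      {bs \<in> ordered_partitions V1 V2 ((True, l, k) # ts). snd (hd bs) = Some e}"
  proof -
    have "hd cs \<in> blocks_of_type V1 V2 (True, l, k)"
      if "cs \<in> ordered_partitions V1 V2 ((True, l, k) # ts)" for cs
      using that Cons_in_ordered_partitions_iff[OF disj]
      by (cases cs) (auto simp: ordered_partitions_def)
    then show ?thesis by blast
  qed
  have "?S \<subseteq> blocks_of_type V1 V2 (True, l, k)" by simp
  from card_ordered_partitions_head[OF fin disj this rest]
  have "card {bs \<in> ordered_partitions V1 V2 ((True, l, k) # ts). snd (hd bs) = Some e} *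
      prod_list (map type_weight ts) = card ?S * (fact (card V1 - k) * fact (card V2 - l))"
    unfolding eq .
  then have "card {bs \<in> ordered_partitions V1 V2 ((True, l, k) # ts). snd (hd bs) = Some e} *
      prod_list (map type_weight ((True, l, k) # ts)) =
      card ?S * type_weight (True, l, k) * (fact (card V1 - k) * fact (card V2 - l))"
    by (simp add: mult_ac)
  \<comment> \<open>\<open>card V1 - k\<close> is rewritten as
    \<open>(card V1 - 1) - (k - 1)\<close> to match the binomial coefficient.\<close>
  also have "\<dots> = (((card V1 - 1) choose (k - 1)) * fact (k - 1) * fact ((card V1 - 1) - (k - 1))) *
     ((card V2 choose l) * fact l * fact (card V2 - l))"
    using k by (simp add: card_blocks_pointed_at[OF fin disj e k] type_weight_def mult_ac)
  also have "\<dots> = fact (card V1 - 1) * fact (card V2)"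
    using le k by (simp only: fact_choose diff_le_mono)
  finally show ?thesis .
qed

section \<open>Counting arrangements\<close>

lemma filter_append_eq:
  assumes "\<forall>b\<in>set ps. P b" "\<forall>b\<in>set us. \<not> P b"
  shows "filter P (ps @ us) = ps" "filter (\<lambda>b. \<not> P b) (ps @ us) = us"
  using assms by (simp_all add: filter_id_conv filter_empty_conv)

text \<open>The cut between \<open>ps\<close> and \<open>us\<close> can be recovered, since all
  permutations of \<open>A\<close> have the same length.\<close>

lemma inj_on_append_permutations:
  "inj_on (\<lambda>(ps, us). cs @ ps @ us) (permutations_of_set A \<times> permutations_of_set B)"
proof (rule inj_onI)
  fix y z assume y: "y \<in> permutations_of_set A \<times> permutations_of_set B"
    and z: "z \<in> permutations_of_set A \<times> permutations_of_set B"
    and eq: "(case y of (ps, us) \<Rightarrow> cs @ ps @ us) = (case z of (ps, us) \<Rightarrow> cs @ ps @ us)"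
  have "length (fst y) = length (fst z)"
    using y z by (auto simp: length_finite_permutations_of_set)
  then show "y = z" using eq by (cases y; cases z) simp
qed

context ground
begin

lemma finite_upset: "finite (upset V1 V2 pt)"
proof (rule finite_subset)
  show "upset V1 V2 pt \<subseteq> Pow (Pow (V1 \<union> V2) \<times> insert None (Some ` V1))"
  proof (intro subsetI PowI)
    fix x b assume "x \<in> upset V1 V2 pt" and b: "b \<in> x"
    then have x: "sp_partition V1 V2 x" by (simp add: upset_def)
    show "b \<in> Pow (V1 \<union> V2) \<times> insert None (Some ` V1)"
      using sp_partitionD(4,7)[OF x b] by (cases b; cases "snd b") auto
  qed
qed (use fin in simp)

lemma finite_arrangements: "finite {bs. arrangement V1 V2 pt bs}"
proof (rule finite_subset)
  show "{bs. arrangement V1 V2 pt bs} \<subseteq> (\<Union>x\<in>upset V1 V2 pt. permutations_of_set x)"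
  proof (intro subsetI, unfold mem_Collect_eq)
    fix bs assume arr: "arrangement V1 V2 pt bs"
    show "bs \<in> (\<Union>x\<in>upset V1 V2 pt. permutations_of_set x)"
      using arrangement.bs_upset[OF arr] permutations_of_setI[OF refl arrangement.dist[OF arr]]
      by (rule UN_I)
  qed
qed (use finite_upset in simp)

text \<open>A prescribed point lies in only one block, so in the pointed case the first block is
  forced; the other pointed blocks and the unpointed ones are permuted independently.\<close>

lemma card_arrangements:
  assumes x: "x \<in> upset V1 V2 pt"
  shows "card {bs. arrangement V1 V2 pt bs \<and> set bs = x} =
    fact (card {b \<in> x. snd b = None}) * fact (card {b \<in> x. snd b \<noteq> None} - (if pt = None then 0 else 1))"
proof -
  note xp = upset_partition[OF x]
  let ?P = "\<lambda>b :: blk. snd b \<noteq> None"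
  obtain q where q: "q \<in> x" "snd q = pt" using x by (auto simp: upset_def)
  have uniq: "b = q" if "b \<in> x" "snd b = pt" "pt \<noteq> None" for b
    using that q sp_partitionD(7)[OF xp that(1)] sp_partitionD(7)[OF xp q(1)]
      sp_partitionD(5)[OF xp that(1) q(1)] by force
  \<comment> \<open>The forced beginning of the list, empty when \<open>pt\<close> is
    \<open>None\<close>.\<close>
  define p0 where "p0 = (if pt = None then [] else [q])"
  let ?A = "{b \<in> x. snd b \<noteq> None} - set p0" and ?B = "{b \<in> x. snd b = None}"
  have fx: "finite x" by (rule sp_partitionD(1)[OF xp])
  have cA: "card ?A = card {b \<in> x. snd b \<noteq> None} - (if pt = None then 0 else 1)"
    using q fx by (auto simp: p0_def card_Diff_singleton_if)
  have p0: "set p0 \<subseteq> {b \<in> x. snd b \<noteq> None}" "distinct p0" using q by (auto simp: p0_def)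
  have "{bs. arrangement V1 V2 pt bs \<and> set bs = x} =
      (\<lambda>(ps, us). p0 @ ps @ us) ` (permutations_of_set ?A \<times> permutations_of_set ?B)"
  proof (intro equalityI subsetI)
    fix bs assume "bs \<in> {bs. arrangement V1 V2 pt bs \<and> set bs = x}"
    then have arr: "arrangement V1 V2 pt bs" and bs: "set bs = x" by auto
    interpret arrangement V1 V2 pt bs by (rule arr)
    let ?us = "filter (\<lambda>b. snd b = None) bs"
    have "\<exists>ps. filter ?P bs = p0 @ ps"
    proof (cases "pt = None")
      case False
      then obtain b ps where ps: "filter ?P bs = b # ps" using np_pos by (cases "filter ?P bs") auto
      then have "bs = b # ps @ ?us" using sorted by simp
      then have "hd bs = b" "b \<in> x" using bs by (metis list.sel(1), metis list.set_intros(1))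
      moreover have "snd (hd bs) = pt" using head False by auto
      ultimately have "b = q" using uniq False by blast
      then show ?thesis using ps False by (simp add: p0_def)
    qed (simp add: p0_def)
    then obtain ps where ps: "filter ?P bs = p0 @ ps" by blast
    have "distinct (p0 @ ps)" using distinct_filter[OF dist, of ?P] ps by simp
    moreover have "set (p0 @ ps) = {b \<in> x. snd b \<noteq> None}" using ps[symmetric] bs by simp
    ultimately have "ps \<in> permutations_of_set ?A" by (intro permutations_of_setI) auto
    moreover have "?us \<in> permutations_of_set ?B"
      using dist bs by (intro permutations_of_setI) auto
    moreover have "bs = p0 @ ps @ ?us" using sorted ps by simp
    ultimately show "bs \<in> (\<lambda>(ps, us). p0 @ ps @ us) ` (permutations_of_set ?A \<times> permutations_of_set ?B)"
      by (intro rev_image_eqI[of "(ps, ?us)"]) simp_all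
  next
    fix bs assume "bs \<in> (\<lambda>(ps, us). p0 @ ps @ us) ` (permutations_of_set ?A \<times> permutations_of_set ?B)"
    then obtain z where z: "bs = (case z of (ps, us) \<Rightarrow> p0 @ ps @ us)"
      "z \<in> permutations_of_set ?A \<times> permutations_of_set ?B" by (elim imageE)
    obtain ps us where "z = (ps, us)" by (cases z)
    then have bs: "bs = p0 @ ps @ us"
      and perms: "ps \<in> permutations_of_set ?A" "us \<in> permutations_of_set ?B" using z by simp_all
    note ps = permutations_of_setD[OF perms(1)] and us = permutations_of_setD[OF perms(2)]
    have set: "set bs = x" using p0 by (auto simp: bs ps(1) us(1))
    have f: "filter ?P bs = p0 @ ps" "filter (\<lambda>b. \<not> ?P b) bs = us"
      unfolding bs append_assoc[symmetric] using p0 ps us by (intro filter_append_eq; auto)+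
    have "arrangement V1 V2 pt bs"
    proof
      show "distinct bs" using p0 ps us by (auto simp: bs)
      show "set bs \<in> upset V1 V2 pt" using set x by simp
      show "bs = filter ?P bs @ filter (\<lambda>b. snd b = None) bs" using f bs by simp
      show "snd (hd bs) = Some e" if "pt = Some e" for e using that q by (simp add: bs p0_def)
    qed
    then show "bs \<in> {bs. arrangement V1 V2 pt bs \<and> set bs = x}" using set by simp
  qed
  moreover have "inj_on (\<lambda>(ps, us). p0 @ ps @ us) (permutations_of_set ?A \<times> permutations_of_set ?B)"
    by (rule inj_on_append_permutations)
  ultimately have "card {bs. arrangement V1 V2 pt bs \<and> set bs = x} =
      card (permutations_of_set ?A \<times> permutations_of_set ?B)" by (simp add: card_image)
  also have "\<dots> = fact (card ?A) * fact (card ?B)" using fx by (simp add: card_cartesian_product)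
  finally show ?thesis unfolding cA by (simp add: mult.commute)
qed

end

section \<open>Arrangements and the index set of the right-hand side\<close>

definition index_types :: "nat \<times> nat \<times> nat list \<times> nat list \<Rightarrow> (bool \<times> nat \<times> nat) list" where
  "index_types t = (case t of (p, q, ls, ks) \<Rightarrow> map (\<lambda>i. (i < p, ls ! i, ks ! i)) [0..<p + q])"

definition arr_index :: "nat set \<Rightarrow> nat set \<Rightarrow> blk list \<Rightarrow> nat \<times> nat \<times> nat list \<times> nat list" where
  "arr_index V1 V2 bs =
     (length (filter (\<lambda>b. snd b \<noteq> None) bs), length (filter (\<lambda>b. snd b = None) bs),
      map (\<lambda>b. card (fst b \<inter> V2)) bs, map (\<lambda>b. card (fst b \<inter> V1)) bs)"

lemma (in arrangement) map_block_type: "map (block_type V1 V2) bs = index_types (arr_index V1 V2 bs)"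
proof (rule nth_equalityI)
  show "length (map (block_type V1 V2) bs) = length (index_types (arr_index V1 V2 bs))"
    by (simp only: index_types_def arr_index_def prod.case length_map length_upt length_bs diff_zero)
  fix i assume "i < length (map (block_type V1 V2) bs)"
  then have i: "i < length bs" "i < np + nu" using length_bs by auto
  have "snd (bs ! i) \<noteq> None \<longleftrightarrow> i < np"
    using nth_pointed[of i] nth_unpointed[of i] i by (meson leI)
  then show "map (block_type V1 V2) bs ! i = index_types (arr_index V1 V2 bs) ! i"
    using i by (simp add: index_types_def arr_index_def block_type_def)
qed

text \<open>The positivity conditions on the tuple say that pointed blocks meet \<open>V1\<close>
  and unpointed ones meet \<open>V2\<close>.\<close>

lemma (in arrangement) arr_index_in_rhs_index:
  assumes "card V1 = k" "card V2 = l" and ob: "ob = (if pt = None then 0 else 1)"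
  shows "arr_index V1 V2 bs \<in> rhs_index k l ob"
  unfolding rhs_index_def arr_index_def mem_Collect_eq prod.case
proof (intro conjI allI impI)
  define a b where "a = np" and "b = nu"
  have "pt \<noteq> None \<Longrightarrow> 1 \<le> a" "pt = None \<Longrightarrow> 1 \<le> b" unfolding a_def b_def by (rule np_pos nu_pos; assumption)+
  then show "1 \<le> np + nu" "ob \<le> np" "Pdef (np + nu) np ob"
    unfolding a_def[symmetric] b_def[symmetric] Pdef_def ob by (cases pt; simp)+
  show "length (map n2 bs) = np + nu" "length (map n1 bs) = np + nu"
    using length_bs by simp_all
  show "sum_list (map n2 bs) = l" "sum_list (map n1 bs) = k" using sum_n1 sum_n2 assms by simp_all
  show "1 \<le> map n2 bs ! i" if "i < np + nu" "np \<le> i" for i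
    using that nth_unpointed[of i] block_ground(4)[of "bs ! i"] length_bs by simp
  show "1 \<le> map n1 bs ! i" if "i < np" for i
    using that nth_pointed[OF that] block_ground(3)[of "bs ! i"] length_bs by simp
qed

context ground
begin

text \<open>The flags in the type list already force the pointed blocks to come first, so being an
  arrangement adds only the condition on the head.\<close>

lemma arrangements_of_index:
  assumes t: "t \<in> rhs_index (card V1) (card V2) ob" and ob: "ob = (if pt = None then 0 else 1)"
  shows "{bs. arrangement V1 V2 pt bs \<and> arr_index V1 V2 bs = t} =
    {bs \<in> ordered_partitions V1 V2 (index_types t). \<forall>e. pt = Some e \<longrightarrow> snd (hd bs) = Some e}"
proof (intro equalityI subsetI)
  fix bs assume "bs \<in> {bs. arrangement V1 V2 pt bs \<and> arr_index V1 V2 bs = t}"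
  then have arr: "arrangement V1 V2 pt bs" and i: "arr_index V1 V2 bs = t" by auto
  interpret arrangement V1 V2 pt bs by (rule arr)
  show "bs \<in> {bs \<in> ordered_partitions V1 V2 (index_types t). \<forall>e. pt = Some e \<longrightarrow> snd (hd bs) = Some e}"
    using dist x map_block_type head i by (simp add: ordered_partitions_def)
next
  fix bs
  assume "bs \<in> {bs \<in> ordered_partitions V1 V2 (index_types t). \<forall>e. pt = Some e \<longrightarrow> snd (hd bs) = Some e}"
  then have d: "distinct bs" and P: "sp_partition V1 V2 (set bs)"
    and m: "map (block_type V1 V2) bs = index_types t"
    and hd: "\<And>e. pt = Some e \<Longrightarrow> snd (hd bs) = Some e" by (auto simp: ordered_partitions_def)
  obtain p q ls ks where tt: "t = (p, q, ls, ks)" by (cases t)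
  have len: "length ls = p + q" "length ks = p + q" "1 \<le> p + q" "Pdef (p + q) p ob"
    using t by (auto simp: tt rhs_index_def)
  have lbs: "length bs = p + q"
    using arg_cong[OF m, of length] by (simp add: tt index_types_def)
  have nth: "block_type V1 V2 (bs ! i) = (i < p, ls ! i, ks ! i)" if "i < p + q" for i
    using arg_cong[OF m, of "\<lambda>xs. xs ! i"] that lbs by (simp add: tt index_types_def)
  have bs: "bs = take p bs @ drop p bs" by simp
  have tk: "\<forall>b\<in>set (take p bs). snd b \<noteq> None"
  proof
    fix b assume "b \<in> set (take p bs)"
    then obtain i where "i < p" "b = bs ! i" by (auto simp: in_set_conv_nth)
    then show "snd b \<noteq> None" using nth[of i] by (simp add: block_type_def)
  qed
  have dr: "\<forall>b\<in>set (drop p bs). \<not> snd b \<noteq> None"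
  proof
    fix b assume "b \<in> set (drop p bs)"
    then obtain i where "i < q" "b = bs ! (p + i)" using lbs by (auto simp: in_set_conv_nth)
    then show "\<not> snd b \<noteq> None" using nth[of "p + i"] by (simp add: block_type_def)
  qed
  have f: "filter (\<lambda>b. snd b \<noteq> None) bs = take p bs" "filter (\<lambda>b. snd b = None) bs = drop p bs"
    using filter_append_eq[OF tk dr] by simp_all
  have "arrangement V1 V2 pt bs"
  proof
    show "distinct bs" by (rule d)
    have "\<exists>b\<in>set bs. snd b = pt"
    proof (cases pt)
      case None
      \<comment> \<open>\<open>Pdef\<close> with \<open>ob = 0\<close> provides an unpointed block;
        the first one stands at position \<open>p\<close>.\<close>
      then have "p < p + q" using len(4) ob by (simp add: Pdef_def)
      then show ?thesis using nth[of p] lbs None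
        by (intro bexI[of _ "bs ! p"]) (auto simp: block_type_def)
    next
      case (Some e)
      then show ?thesis using hd len(3) lbs by (intro bexI[of _ "hd bs"] hd_in_set) auto
    qed
    then show "set bs \<in> upset V1 V2 pt" using P by (simp add: upset_def)
    show "bs = filter (\<lambda>b. snd b \<noteq> None) bs @ filter (\<lambda>b. snd b = None) bs"
      unfolding f by simp
  qed (rule hd)
  moreover have "map (\<lambda>b. card (fst b \<inter> V2)) bs = ls" "map (\<lambda>b. card (fst b \<inter> V1)) bs = ks"
    using nth lbs len by (auto simp: block_type_def intro!: nth_equalityI)
  then have "arr_index V1 V2 bs = t" using lbs unfolding arr_index_def f tt by simp
  ultimately show "bs \<in> {bs. arrangement V1 V2 pt bs \<and> arr_index V1 V2 bs = t}" by simp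
qed

text \<open>Two multinomial counts cover this: a free head for \<open>ob = 0\<close>, a head pointed
  at \<open>e\<close> for \<open>ob = 1\<close>.\<close>

lemma card_arrangements_of_index:
  assumes t: "t \<in> rhs_index (card V1) (card V2) ob" and ob: "ob = (if pt = None then 0 else 1)"
  shows "card {bs. arrangement V1 V2 pt bs \<and> arr_index V1 V2 bs = t} *
      prod_list (map type_weight (index_types t)) = fact (card V1 - ob) * fact (card V2)"
proof -
  obtain p q ls ks where tt: "t = (p, q, ls, ks)" by (cases t)
  have len: "length ls = p + q" "length ks = p + q" "ob \<le> p" "1 \<le> p + q"
    and sums: "sum_list ls = card V2" "sum_list ks = card V1"
    and pos: "\<And>i. i < p + q \<Longrightarrow> p \<le> i \<Longrightarrow> 1 \<le> ls ! i" "\<And>i. i < p \<Longrightarrow> 1 \<le> ks ! i"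
    using t by (auto simp: tt rhs_index_def)
  have valid: "\<forall>s\<in>set (index_types t). valid_type s"
    using pos by (auto simp: tt index_types_def valid_type_def)
  have "map (\<lambda>s. snd (snd s)) (index_types t) = map ((!) ks) [0..<length ks]"
    "map (\<lambda>s. fst (snd s)) (index_types t) = map ((!) ls) [0..<length ls]"
    using len by (simp_all add: tt index_types_def)
  then have sum: "(\<Sum>s\<leftarrow>index_types t. snd (snd s)) = card V1"
    "(\<Sum>s\<leftarrow>index_types t. fst (snd s)) = card V2"
    using sums by (simp_all add: map_nth)
  show ?thesis
  proof (cases pt)
    case None
    then show ?thesis using card_ordered_partitions[OF fin disj valid sum] ob
      unfolding arrangements_of_index[OF t ob] by simp
  next
    case (Some e)
    then have e: "e \<in> V1" using wp by (simp add: well_pointed_def)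
    have p: "1 \<le> p" using Some ob len(3) by simp
    \<comment> \<open>Since \<open>p\<close> is at least 1, position 0 carries a pointed type, as
      the count with a prescribed head requires.\<close>
    then have c: "index_types t = (True, ls ! 0, ks ! 0) # map (\<lambda>i. (i < p, ls ! i, ks ! i)) [1..<p + q]"
      by (simp add: tt index_types_def upt_conv_Cons)
    show ?thesis
      using card_ordered_partitions_pointed_head[OF fin disj e, of
          "map (\<lambda>i. (i < p, ls ! i, ks ! i)) [1..<p + q]" "ks ! 0" "ls ! 0"]
        valid sum pos(2)[of 0] p Some ob
      unfolding arrangements_of_index[OF t ob] c by simp
  qed
qed

end

text \<open>\<open>type_weight\<close> subtracts 1 from k_i exactly at the positions
  \<open>i < p\<close>, so one product over all positions covers both products in
  \<open>rhs_coeff\<close>.\<close>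

lemma rhs_coeff_eq:
  "rhs_coeff ob (p, q, ls, ks) =
     1 / (of_nat (prod_list (map type_weight (index_types (p, q, ls, ks)))) * (fact q * fact (p - ob)))"
proof -
  let ?w = "\<lambda>i. fact (ls ! i) * fact (ks ! i - of_bool (i < p)) :: nat"
  have "prod_list (map type_weight (index_types (p, q, ls, ks))) = (\<Prod>i\<in>set [0..<p + q]. ?w i)"
    by (subst prod.distinct_set_conv_list) (simp_all add: index_types_def type_weight_def comp_def)
  also have "set [0..<p + q] = {..<p} \<union> {p..<p + q}" by auto
  also have "(\<Prod>i\<in>\<dots>. ?w i) = (\<Prod>i<p. ?w i) * (\<Prod>i\<in>{p..<p + q}. ?w i)"
    by (rule prod.union_disjoint) auto
  also have "(\<Prod>i<p. ?w i) = (\<Prod>i<p. fact (ls ! i) * fact (ks ! i - 1))"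
    by (rule prod.cong) auto
  also have "(\<Prod>i\<in>{p..<p + q}. ?w i) = (\<Prod>i\<in>{p..<p + q}. fact (ls ! i) * fact (ks ! i))"
    by (rule prod.cong) auto
  finally show ?thesis
    by (simp add: rhs_coeff_def prod_dividef of_nat_prod del: of_nat_fact) (simp add: of_nat_fact)
qed

lemma (in arrangement) rhs_left_arr_index:
  "rhs_left (arr_index V1 V2 bs) =
     prod_car (map (\<lambda>b. Pcar (n2 b + n1 b) (n1 b) (if snd b \<noteq> None then 1 else 0)) bs)"
proof -
  have "map (\<lambda>i. Pcar (map n2 bs ! i + map n1 bs ! i) (map n1 bs ! i) (if i < np then 1 else 0)) [0..<np + nu]
      = map (\<lambda>b. Pcar (n2 b + n1 b) (n1 b) (if snd b \<noteq> None then 1 else 0)) bs" (is "?L = ?R")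
  proof (rule nth_equalityI)
    fix i assume "i < length ?L"
    then have i: "i < np + nu" "i < length bs" using length_bs by auto
    have "snd (bs ! i) \<noteq> None \<longleftrightarrow> i < np"
      using nth_pointed[of i] nth_unpointed[of i] i by (meson leI)
    then show "?L ! i = ?R ! i" using i by simp
  qed (use length_bs in simp)
  then show ?thesis by (simp only: rhs_left_def arr_index_def prod.case)
qed

theorem mainTheorem14:
  fixes k l ob :: nat
  assumes "ob \<le> 1" and "Pdef (k + l) k ob"
  shows "\<forall>X Y. (1 / (fact l * fact (k - ob))) * Delta_coeff (Pcar (k + l) k ob) X Y =
           tensor_coeff (rhs_index k l ob) (rhs_coeff ob) rhs_left (rhs_right ob) X Y"
proof (intro allI)
  fix X Y
  define V1 where "V1 = {1..k}"
  define V2 where "V2 = {k+1..k+l}"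
  define pt where "pt = (if ob = 1 then Some 1 else None :: nat option)"
  have ob: "ob = (if pt = None then 0 else 1)" using assms(1) by (auto simp: pt_def)
  interpret ground V1 V2 pt
    using assms by unfold_locales (auto simp: V1_def V2_def pt_def well_pointed_def Pdef_def)
  have cV: "card V1 = k" "card V2 = l" by (simp_all add: V1_def V2_def)
  have C: "Pcar (k + l) k ob = carr"
    unfolding V1_def V2_def pt_def by (rule Pcar_eq) simp
  let ?U = "upset V1 V2 pt" and ?E = "{bs. arrangement V1 V2 pt bs}" and ?I = "rhs_index k l ob"
  let ?ix = "arr_index V1 V2"
  define Q where "Q x \<longleftrightarrow> cls_eq (intv carr (bot_of carr) [x]) X \<and> cls_eq (intv carr [x] (top_of carr)) Y" for x
  define Q' where "Q' t \<longleftrightarrow> cls_eq (rhs_left t) X \<and> cls_eq (rhs_right ob t) Y" for t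
  \<comment> \<open>The part of \<open>rhs_coeff\<close> that belongs to the right factor; it is the
    inverse of the number of arrangements of a single partition.\<close>
  define w where "w t = (case t of (p, q, ls, ks) \<Rightarrow> (1 / (fact q * fact (p - ob)) :: rat))"
    for t :: "nat \<times> nat \<times> nat list \<times> nat list"
  \<comment> \<open>The classes of both intervals depend only on the tuple of sizes, so the
    condition on \<open>x\<close> becomes one on the index.\<close>
  have QQ: "Q (set bs) \<longleftrightarrow> Q' (?ix bs)" if "arrangement V1 V2 pt bs" for bs
  proof -
    interpret arrangement V1 V2 pt bs by (rule that)
    have "rhs_right ob (?ix bs) = Pcar (np + nu) np ob"
      by (simp only: rhs_right_def arr_index_def prod.case)
    then show ?thesis
      unfolding Q_def Q'_def cls_eq_cong[OF lower_interval_class]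
        cls_eq_cong[OF upper_interval_class[OF ob]] rhs_left_arr_index by simp
  qed
  define c where "c t = card {bs. arrangement V1 V2 pt bs \<and> ?ix bs = t}" for t
  have c: "c t * prod_list (map type_weight (index_types t)) = fact (k - ob) * fact l"
    if "t \<in> ?I" for t
    using card_arrangements_of_index[of t ob] that ob cV unfolding c_def by simp
  have sub: "?ix ` ?E \<subseteq> ?I"
    by (intro image_subsetI arrangement.arr_index_in_rhs_index[OF _ cV ob]) simp
  \<comment> \<open>Every index is realised, because \<open>c t\<close> is a factor of a nonzero
    product of factorials. This also makes the index set finite; sums over an infinite set would be
    0 by convention.\<close>
  have "?I \<subseteq> ?ix ` ?E"
  proof
    fix t assume "t \<in> ?I"
    then have "c t \<noteq> 0" using c[of t] by (metis fact_nonzero mult_eq_0_iff)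
    then have "{bs. arrangement V1 V2 pt bs \<and> ?ix bs = t} \<noteq> {}" unfolding c_def by force
    then show "t \<in> ?ix ` ?E" by blast
  qed
  then have finI: "finite ?I" using finite_arrangements by (rule finite_surj[rotated])
  \<comment> \<open>\<open>c t\<close> is (k-o)! l! divided by the weights of the blocks, so the
    normalisation on the left leaves exactly the denominators of \<open>rhs_coeff\<close>.\<close>
  have weight: "of_nat (c t) * w t / (fact l * fact (k - ob)) = rhs_coeff ob t" if "t \<in> ?I" for t
  proof -
    obtain p q ls ks where t: "t = (p, q, ls, ks)" by (cases t)
    let ?m = "prod_list (map type_weight (index_types t))"
    have "of_nat (c t) * of_nat ?m = (fact (k - ob) * fact l :: rat)"
      using arg_cong[OF c[OF that], of "of_nat :: nat \<Rightarrow> rat"] by simp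
    moreover from this have "of_nat ?m \<noteq> (0 :: rat)" by (metis fact_nonzero mult_eq_0_iff)
    ultimately have "of_nat (c t) / (fact l * fact (k - ob)) = 1 / (of_nat ?m :: rat)"
      by (simp add: field_simps)
    then have "of_nat (c t) * w t / (fact l * fact (k - ob)) = 1 / (of_nat ?m :: rat) * w t"
      by (metis times_divide_eq_left mult.commute)
    then show ?thesis by (simp add: w_def t rhs_coeff_eq)
  qed
  have "Delta_coeff carr X Y = (\<Sum>x\<in>{x \<in> carr. Q (hd x)}. 1)"
    unfolding Delta_coeff_def tensor_coeff_def by (rule sum.cong) (auto simp: Q_def)
  also have "{x \<in> carr. Q (hd x)} = (\<lambda>x. [x]) ` {x \<in> ?U. Q x}" by auto
  also have "(\<Sum>x\<in>\<dots>. 1 :: rat) = (\<Sum>x\<in>{x \<in> ?U. Q x}. 1)"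
    by (subst sum.reindex) (auto simp: inj_on_def)
  also have "\<dots> = (\<Sum>x\<in>?U. if Q x then 1 else 0)"
    by (rule sum.inter_filter[OF finite_upset])
  \<comment> \<open>Each contributing \<open>x\<close> is spread over its arrangements, with equal
    weights that add up to 1.\<close>
  also have "\<dots> = (\<Sum>x\<in>?U. \<Sum>bs\<in>{bs. bs \<in> ?E \<and> set bs = x}. if Q' (?ix bs) then w (?ix bs) else 0)"
  proof (rule sum.cong[OF refl])
    fix x assume x: "x \<in> ?U"
    let ?F = "fact (card {b \<in> x. snd b = None}) *
      fact (card {b \<in> x. snd b \<noteq> None} - (if pt = None then 0 else 1)) :: rat"
    have "(if Q' (?ix bs) then w (?ix bs) else 0) = (if Q x then 1 / ?F else 0)"
      if "arrangement V1 V2 pt bs" "set bs = x" for bs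
    proof -
      interpret arrangement V1 V2 pt bs by (rule that(1))
      have "w (?ix bs) = 1 / ?F"
        using npointed_x unfolding npointed_single nunpointed_single that(2)
        by (simp only: w_def arr_index_def prod.case ob)
      then show ?thesis using QQ[OF that(1)] that(2) by simp
    qed
    then have "(\<Sum>bs\<in>{bs. bs \<in> ?E \<and> set bs = x}. if Q' (?ix bs) then w (?ix bs) else 0) =
        (\<Sum>bs\<in>{bs. arrangement V1 V2 pt bs \<and> set bs = x}. if Q x then 1 / ?F else 0)"
      by (intro sum.cong) auto
    also have "\<dots> = ?F * (if Q x then 1 / ?F else 0)"
      unfolding sum_constant card_arrangements[OF x] by simp
    also have "\<dots> = (if Q x then 1 else 0)" by simp
    finally show "(if Q x then 1 else 0) =
      (\<Sum>bs\<in>{bs. bs \<in> ?E \<and> set bs = x}. if Q' (?ix bs) then w (?ix bs) else 0)" by simp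
  qed
  also have "\<dots> = (\<Sum>bs\<in>?E. if Q' (?ix bs) then w (?ix bs) else 0)"
    by (rule sum.group[OF finite_arrangements finite_upset]) (intro image_subsetI, rule arrangement.bs_upset, simp)
  \<comment> \<open>Regrouping the arrangements by index collects \<open>c t\<close> equal terms for
    each tuple.\<close>
  also have "\<dots> = (\<Sum>t\<in>?I. \<Sum>bs\<in>{bs. bs \<in> ?E \<and> ?ix bs = t}. if Q' (?ix bs) then w (?ix bs) else 0)"
    by (rule sum.group[OF finite_arrangements finI sub, symmetric])
  also have "\<dots> = (\<Sum>t\<in>?I. if Q' t then of_nat (c t) * w t else 0)"
    by (intro sum.cong refl) (simp add: c_def)
  finally have "1 / (fact l * fact (k - ob)) * Delta_coeff carr X Y =
      (\<Sum>t\<in>?I. if Q' t then of_nat (c t) * w t / (fact l * fact (k - ob)) else 0)"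
    by (simp add: sum_divide_distrib if_distrib[where f = "\<lambda>x. x / _"] cong: if_cong)
  also have "\<dots> = (\<Sum>t\<in>?I. if Q' t then rhs_coeff ob t else 0)"
    by (intro sum.cong refl) (simp add: weight)
  also have "\<dots> = tensor_coeff ?I (rhs_coeff ob) rhs_left (rhs_right ob) X Y"
    unfolding tensor_coeff_def Q'_def by (rule sum.inter_filter[OF finI, symmetric])
  finally show "1 / (fact l * fact (k - ob)) * Delta_coeff (Pcar (k + l) k ob) X Y =
           tensor_coeff ?I (rhs_coeff ob) rhs_left (rhs_right ob) X Y" unfolding C .
qed

end
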